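(* Let $B>0$ and $\sigma^2>0$ be fixed, with $\sigma^2$ known. Let $Y_1,\dots,Y_n$ satisfy $Y_i = f(i/n)+\varepsilon_i$, $1\le i\le n$, where the $\varepsilon_i$ are i.i.d. $\mathcal{N}(0,\sigma^2)$. Then, for every integer $l>0$, there exist an estimator $\hat f_n(x) := \hat f_n(x,Y_1,\dots,Y_n,l)$, $x\in[0,1]$, and an integer $n_0$ such that, for every $t$ with $0<t\le l$, for some constant $D(B,l)$ and for every $n\ge n_0$, $$\sup_{f\in\Sigma(t)} E_f\Vert \hat f_n - f\Vert_\infty \le D(B,l)\, r_n(t), \qquad r_n(t)=\left(\frac{\log n}{n}\right)^{t/(2t+1)}.$$
   Context: Wavelets: $\{\phi_m,\psi_{jm}\}$ is the orthonormal basis of $L^2([0,1])$ given by Daubechies wavelets on the unit interval (boundary-corrected, Cohen–Daubechies–Vial), of regularity sufficient for the wavelet characterisation of the Hölder spaces $\mathcal{C}^t([0,1])$ for all $t$ considered; here $\phi_m=\phi(\cdot-m)$, $\psi_{jm}=2^{j/2}\psi(2^j\cdot-m)$ (with the usual modification near the boundary), and $\langle\cdot,\cdot\rangle$ is the inner product of $L^2([0,1])$. For $t>0$ put $$\Vert f\Vert_{t,\infty}=\max\Big(\sup_m|\langle\phi_m,f\rangle|,\ \sup_{j,m}2^{j(t+1/2)}|\langle\psi_{jm},f\rangle|\Big).$$ On continuous functions on $[0,1]$ this is a norm equivalent to the Hölder norm of $\mathcal{C}^t$ (Hölder–Zygmund norm when $t$ is an integer). For fixed $B>0$, $\Sigma(t)$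 is the set of continuous functions $f:[0,1]\to\mathbb{R}$ with $\Vert f\Vert_{t,\infty}\le B$. An estimator is a function of $x$ and of the data $(Y_1,\dots,Y_n)$ (it may use the known $\sigma^2$ and $l$, but not $t$ or $f$). $E_f$ denotes expectation when the regression function is $f$, and $\Vert\cdot\Vert_\infty$ is the sup-norm on $[0,1]$. $D(B,l)$ denotes a finite constant depending on $B$ and $l$ (with $\sigma^2$ and the wavelet basis fixed).
   Formalization: The constant D(B,l) is allowed to depend on t as well (it is chosen after t, for σ² and the basis fixed); a D uniform over all 0<t≤l is impossible, since for fixed n the maximal risk over Σ(t) is unbounded as t→0 while r_n(t)≤1. *)

theory Defs
  imports "HOL-Probability.Probability"
begin

section \<open>Orthonormal bases of \<open>L\<^sup>2(A)\<close>\<close>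

definition L2_fun :: "real set \<Rightarrow> (real \<Rightarrow> real) \<Rightarrow> bool" where
  "L2_fun A f \<longleftrightarrow> set_borel_measurable lborel A f \<and> set_integrable lborel A (\<lambda>x. (f x)\<^sup>2)"

definition L2_inner :: "real set \<Rightarrow> (real \<Rightarrow> real) \<Rightarrow> (real \<Rightarrow> real) \<Rightarrow> real" where
  "L2_inner A f g = (LBINT x:A. f x * g x)"

definition L2_orthonormal :: "real set \<Rightarrow> 'i set \<Rightarrow> ('i \<Rightarrow> real \<Rightarrow> real) \<Rightarrow> bool" where
  "L2_orthonormal A I e \<longleftrightarrow>
     (\<forall>i\<in>I. L2_fun A (e i)) \<and>
     (\<forall>i\<in>I. \<forall>k\<in>I. L2_inner A (e i) (e k) = (if i = k then 1 else 0))"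

definition L2_orthonormal_basis :: "real set \<Rightarrow> 'i set \<Rightarrow> ('i \<Rightarrow> real \<Rightarrow> real) \<Rightarrow> bool" where
  "L2_orthonormal_basis A I e \<longleftrightarrow>
     L2_orthonormal A I e \<and>
     (\<forall>f \<epsilon>. L2_fun A f \<longrightarrow> \<epsilon> > 0 \<longrightarrow>
        (\<exists>F c. finite F \<and> F \<subseteq> I \<and> (LBINT x:A. (f x - (\<Sum>i\<in>F. c i * e i x))\<^sup>2) < \<epsilon>))"


section \<open>Daubechies wavelets on the line\<close>

text \<open>
  A Daubechies filter with \<open>N\<close> vanishing moments has the minimal length \<open>2N\<close>. As in
  Cohen, Daubechies and Vial (Appl. Comput. Harmon. Anal. 1, 1993) it is shifted so that its
  support, and that of the scaling function, is \<open>{-N+1..N}\<close>. All choices of the phase are allowed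
  (extremal phase, least asymmetric).
\<close>

definition daubechies_filter :: "nat \<Rightarrow> (int \<Rightarrow> real) \<Rightarrow> bool" where
  "daubechies_filter N h \<longleftrightarrow>
     (\<forall>k. k \<notin> {1 - int N..int N} \<longrightarrow> h k = 0) \<and>
     (\<Sum>k = 1 - int N..int N. h k) = sqrt 2 \<and>
     (\<forall>m. (\<Sum>k = 1 - int N..int N. h k * h (k + 2 * m)) = (if m = 0 then 1 else 0)) \<and>
     (\<forall>p<N. (\<Sum>k = 1 - int N..int N. (-1) powi k * real_of_int k ^ p * h k) = 0)"

definition scaling_function :: "nat \<Rightarrow> (int \<Rightarrow> real) \<Rightarrow> (real \<Rightarrow> real) \<Rightarrow> bool" where
  "scaling_function N h \<phi> \<longleftrightarrow>
     continuous_on UNIV \<phi> \<and>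
     (\<forall>x. x \<notin> {1 - real N..real N} \<longrightarrow> \<phi> x = 0) \<and>
     (\<forall>x. \<phi> x = sqrt 2 * (\<Sum>k = 1 - int N..int N. h k * \<phi> (2 * x - of_int k))) \<and>
     (LBINT x. \<phi> x) = 1 \<and>
     L2_orthonormal UNIV UNIV (\<lambda>(m::int) x. \<phi> (x - of_int m))"

definition mother_wavelet :: "nat \<Rightarrow> (int \<Rightarrow> real) \<Rightarrow> (real \<Rightarrow> real) \<Rightarrow> real \<Rightarrow> real" where
  "mother_wavelet N h \<phi> x =
     sqrt 2 * (\<Sum>k = 1 - int N..int N. (-1) powi k * h (1 - k) * \<phi> (2 * x - of_int k))"

text \<open>
  Hoelder regularity strictly larger than \<open>l\<close>, which together with more than \<open>l\<close> vanishing moments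
  is what the wavelet characterisation of the Hoelder(-Zygmund) spaces of all orders \<open>t \<le> l\<close> needs.
\<close>

definition regularity_above :: "nat \<Rightarrow> (real \<Rightarrow> real) \<Rightarrow> bool" where
  "regularity_above l \<phi> \<longleftrightarrow>
     (\<forall>i<l. \<forall>x. (deriv ^^ i) \<phi> differentiable (at x)) \<and>
     (\<exists>\<alpha>>0. \<exists>C. \<forall>x y. \<bar>(deriv ^^ l) \<phi> x - (deriv ^^ l) \<phi> y\<bar> \<le> C * \<bar>x - y\<bar> powr \<alpha>)"


section \<open>Boundary correction\<close>

text \<open>
  The functions on the half line \<open>[0,\<infinity>)\<close> which together with the interior translates
  \<open>\<phi>(\<cdot> - m)\<close>, \<open>m \<ge> N\<close>, reproduce the polynomials of degree less than \<open>N\<close>: the sum runs over the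
  translates which are not interior but whose support meets the half line.
\<close>

definition raw_edge :: "nat \<Rightarrow> (real \<Rightarrow> real) \<Rightarrow> nat \<Rightarrow> real \<Rightarrow> real" where
  "raw_edge N \<phi> k x = (\<Sum>i = k..2 * N - 2. real (i choose k) * \<phi> (x + real i - real N + 1))"

text \<open>
  The edge scaling functions \<open>\<phi>E k\<close> are an orthonormalisation of these \<open>N\<close> functions in
  \<open>L\<^sup>2([0,\<infinity>))\<close>. The edge wavelets \<open>\<psi>E k\<close> belong to the next finer half-line space and are an
  orthonormal basis of the orthogonal complement, in that space, of the coarser half-line space
  and the interior wavelets; this complement has dimension \<open>N\<close>. The choice of the two orthonormal
  bases is left open. Values at negative arguments are irrelevant.
\<close>

definition edge_system ::
    "nat \<Rightarrow> (real \<Rightarrow> real) \<Rightarrow> (real \<Rightarrow> real) \<Rightarrow> (nat \<Rightarrow> real \<Rightarrow> real) \<Rightarrow> (nat \<Rightarrow> real \<Rightarrow> real) \<Rightarrow> bool"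
  where
  "edge_system N \<phi> \<psi> \<phi>E \<psi>E \<longleftrightarrow>
     (\<forall>k<N. \<exists>c. \<forall>x\<ge>0. \<phi>E k x = (\<Sum>i<N. c i * raw_edge N \<phi> i x)) \<and>
     L2_orthonormal {0..} {..<N} \<phi>E \<and>
     (\<forall>k<N. \<exists>c d. \<forall>x\<ge>0. \<psi>E k x =
        (\<Sum>i<N. c i * \<phi>E i (2 * x)) + (\<Sum>m = N..3 * N - 2. d m * \<phi> (2 * x - real m))) \<and>
     L2_orthonormal {0..} {..<N} \<psi>E \<and>
     (\<forall>k<N. \<forall>i<N. L2_inner {0..} (\<psi>E k) (\<phi>E i) = 0) \<and>
     (\<forall>k<N. \<forall>m\<ge>N. L2_inner {0..} (\<psi>E k) (\<lambda>x. \<phi> (x - real m)) = 0 \<and>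
                  L2_inner {0..} (\<psi>E k) (\<lambda>x. \<psi> (x - real m)) = 0)"

text \<open>
  Level \<open>j\<close> on \<open>[0,1]\<close> consists of \<open>N\<close> left edge functions, the dilated translates
  \<open>2\<^bsup>j/2\<^esup> f(2\<^sup>j x - m)\<close> for \<open>N \<le> m < 2\<^sup>j - N\<close>, and \<open>N\<close> right edge functions; the latter are
  given as functions of the rescaled distance to the endpoint \<open>1\<close>.
\<close>

definition interval_level ::
    "nat \<Rightarrow> (real \<Rightarrow> real) \<Rightarrow> (nat \<Rightarrow> real \<Rightarrow> real) \<Rightarrow> (nat \<Rightarrow> real \<Rightarrow> real) \<Rightarrow> nat \<Rightarrow> nat \<Rightarrow> real \<Rightarrow> real"
  where
  "interval_level N f fL fR j m x = 2 powr (real j / 2) *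
     (if m < N then fL m (2 ^ j * x)
      else if m < 2 ^ j - N then f (2 ^ j * x - real m)
      else fR (2 ^ j - 1 - m) (2 ^ j * (1 - x)))"

definition wavelet_indices :: "nat \<Rightarrow> (nat \<times> nat) set" where
  "wavelet_indices J = (SIGMA j:{J..}. {..<2 ^ j})"

text \<open>
  \<open>\<Phi> m\<close>, \<open>m < 2\<^sup>J\<close>, and \<open>\<Psi> j m\<close>, \<open>j \<ge> J\<close>, \<open>m < 2\<^sup>j\<close>, form a Cohen--Daubechies--Vial basis of
  \<open>L\<^sup>2([0,1])\<close> of regularity larger than \<open>l\<close> with coarsest level \<open>J\<close>. The right edge is the left
  edge construction for the reflected functions \<open>\<phi>(1 - \<cdot>)\<close>, \<open>\<psi>(1 - \<cdot>)\<close>. The last conjunct is a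
  theorem of Cohen, Daubechies and Vial.
\<close>

definition cdv_basis ::
    "nat \<Rightarrow> nat \<Rightarrow> (nat \<Rightarrow> real \<Rightarrow> real) \<Rightarrow> (nat \<Rightarrow> nat \<Rightarrow> real \<Rightarrow> real) \<Rightarrow> bool" where
  "cdv_basis l J \<Phi> \<Psi> \<longleftrightarrow>
     (\<exists>N h \<phi> \<psi> \<phi>L \<psi>L \<phi>R \<psi>R.
        l < N \<and> 2 * N \<le> 2 ^ J \<and>
        daubechies_filter N h \<and> scaling_function N h \<phi> \<and> regularity_above l \<phi> \<and>
        \<psi> = mother_wavelet N h \<phi> \<and>
        edge_system N \<phi> \<psi> \<phi>L \<psi>L \<and>
        edge_system N (\<lambda>x. \<phi> (1 - x)) (\<lambda>x. \<psi> (1 - x)) \<phi>R \<psi>R \<and>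
        (\<forall>m<2 ^ J. \<forall>x\<in>{0..1}. \<Phi> m x = interval_level N \<phi> \<phi>L \<phi>R J m x) \<and>
        (\<forall>(j, m)\<in>wavelet_indices J. \<forall>x\<in>{0..1}. \<Psi> j m x = interval_level N \<psi> \<psi>L \<psi>R j m x)) \<and>
     L2_orthonormal_basis {0..1} ({..<2 ^ J} <+> wavelet_indices J)
       (case_sum \<Phi> (\<lambda>(j, m). \<Psi> j m))"


section \<open>Smoothness classes\<close>

definition wavelet_norm ::
    "nat \<Rightarrow> (nat \<Rightarrow> real \<Rightarrow> real) \<Rightarrow> (nat \<Rightarrow> nat \<Rightarrow> real \<Rightarrow> real) \<Rightarrow> real \<Rightarrow> (real \<Rightarrow> real) \<Rightarrow> ereal" where
  "wavelet_norm J \<Phi> \<Psi> t f = max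
     (SUP m\<in>{..<2 ^ J}. ereal \<bar>L2_inner {0..1} (\<Phi> m) f\<bar>)
     (SUP (j, m)\<in>wavelet_indices J.
        ereal (2 powr (real j * (t + 1/2)) * \<bar>L2_inner {0..1} (\<Psi> j m) f\<bar>))"

definition smoothness_class ::
    "nat \<Rightarrow> (nat \<Rightarrow> real \<Rightarrow> real) \<Rightarrow> (nat \<Rightarrow> nat \<Rightarrow> real \<Rightarrow> real) \<Rightarrow> real \<Rightarrow> real \<Rightarrow> (real \<Rightarrow> real) set"
  where
  "smoothness_class J \<Phi> \<Psi> B t =
     {f. continuous_on {0..1} f \<and> wavelet_norm J \<Phi> \<Psi> t f \<le> ereal B}"


section \<open>The regression model\<close>

definition sup_dist :: "(real \<Rightarrow> real) \<Rightarrow> (real \<Rightarrow> real) \<Rightarrow> ennreal" where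
  "sup_dist g f = (SUP x\<in>{0..1}. ennreal \<bar>g x - f x\<bar>)"

definition noise :: "real \<Rightarrow> nat \<Rightarrow> (nat \<Rightarrow> real) measure" where
  "noise \<sigma> n = (\<Pi>\<^sub>M i\<in>{1..n}. density lborel (\<lambda>x. ennreal (normal_density 0 \<sigma> x)))"

definition observations :: "nat \<Rightarrow> (real \<Rightarrow> real) \<Rightarrow> (nat \<Rightarrow> real) \<Rightarrow> nat \<Rightarrow> real" where
  "observations n f \<epsilon> = (\<lambda>i\<in>{1..n}. f (real i / real n) + \<epsilon> i)"

text \<open>
  The second condition is not implied by the first, as the supremum is over an uncountable set;
  it makes the expected sup-norm loss well defined (\<open>\<integral>\<^sup>+\<close> of a non-measurable function is only a
  lower integral).
\<close>

definition estimator :: "nat \<Rightarrow> ((nat \<Rightarrow> real) \<Rightarrow> real \<Rightarrow> real) \<Rightarrow> bool" where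
  "estimator n T \<longleftrightarrow>
     (\<forall>x\<in>{0..1}. (\<lambda>y. T y x) \<in> borel_measurable (\<Pi>\<^sub>M i\<in>{1..n}. borel)) \<and>
     (\<forall>f. continuous_on {0..1} f \<longrightarrow>
        (\<lambda>y. sup_dist (T y) f) \<in> borel_measurable (\<Pi>\<^sub>M i\<in>{1..n}. borel))"

definition sup_risk :: "real \<Rightarrow> nat \<Rightarrow> ((nat \<Rightarrow> real) \<Rightarrow> real \<Rightarrow> real) \<Rightarrow> (real \<Rightarrow> real) \<Rightarrow> ennreal" where
  "sup_risk \<sigma> n T f = (\<integral>\<^sup>+\<epsilon>. sup_dist (T (observations n f \<epsilon>)) f \<partial>noise \<sigma> n)"

definition rate :: "nat \<Rightarrow> real \<Rightarrow> real" where
  "rate n t = (ln (real n) / real n) powr (t / (2 * t + 1))"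

end

theory Submission
  imports Defs
begin

text \<open>
  The estimator soft-thresholds empirical wavelet coefficients on all levels \<open>j\<close> with
  \<open>2\<^sup>j \<le> n\<close>, at the threshold \<open>\<tau> = 3 \<sigma> sqrt (log n / n)\<close>, which involves neither \<open>t\<close> nor \<open>B\<close>.

  It adapts to \<open>t\<close> for the following reason. A coefficient \<open>\<beta>\<close> of \<open>f \<in> \<Sigma>(t)\<close> on level \<open>j\<close> satisfies
  \<open>\<bar>\<beta>\<bar> \<le> b 2\<^bsup>-j(t+1/2)\<^esup>\<close>, and if the noise in its empirical version stays below \<open>\<tau>\<close>, thresholding
  commits an error of at most \<open>min \<bar>\<beta>\<bar> (2\<tau>)\<close>. On one level only boundedly many basis functions overlap
  and each has size \<open>2\<^bsup>j/2\<^esup>\<close>, so that level contributes a multiple of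
  \<open>min (b 2\<^bsup>-jt\<^esup>) (2\<tau> 2\<^bsup>j/2\<^esup>)\<close> to the sup-norm error. Up to the level at which the two terms agree this
  grows geometrically, and from there on it decays geometrically; hence the sum over all levels is
  of the order of its largest term, which is \<open>r\<^sub>n(t)\<close> (\<open>balanced_geometric_sum\<close>).

  Three further contributions are of smaller order.
  \<^item> Bias of the design: the empirical coefficients are those of the step function that takes the value
    \<open>Y\<^sub>k\<close> on the interval from \<open>(k-1)/n\<close> to \<open>k/n\<close>. Its distance from \<open>f\<close>, and with it the bias, is
    controlled by the oscillation of \<open>f\<close> on intervals of length \<open>1/n\<close> (\<open>step_coef_bias\<close>).
    Summing the wavelet series shows that \<open>f\<close> is Hoelder of some order \<open>s > t/(2t+1)\<close> (\<open>hoelder\<close>).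
  \<^item> Truncation: the levels with \<open>2\<^sup>j > n\<close> contribute a multiple of \<open>n\<^bsup>-t\<^esup>\<close> (\<open>detail_tail\<close>).
  \<^item> Large noise: the noise in an empirical coefficient is Gaussian with variance at most \<open>\<sigma>\<^sup>2/n\<close>
    (\<open>step_weights_sum_squares\<close>), so that its expected excess over \<open>\<tau>\<close> is of order \<open>n\<^bsup>-4\<^esup>\<close>
    (\<open>coefficient_noise_excess\<close>), while there are only \<open>O(n)\<close> coefficients of weight at most \<open>n\<close>.

  All this takes place in the locale \<open>local_lipschitz_basis\<close>. That the Cohen--Daubechies--Vial wavelets
  satisfy its assumptions (\<open>cdv_local_lipschitz\<close>) holds because they are dilates and translates of
  finitely many compactly supported Lipschitz functions.
\<close>


section \<open>Soft thresholding\<close>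

definition soft_threshold :: "real \<Rightarrow> real \<Rightarrow> real" where
  "soft_threshold \<tau> x = x - max (- \<tau>) (min \<tau> x)"

text \<open>
  Soft thresholding is nonexpansive, which takes care of the bias \<open>d\<close> and of the part of the noise
  \<open>\<xi>\<close> that exceeds \<open>\<tau>\<close>. What remains is noise of size at most \<open>\<tau>\<close>, and then the thresholded value lies between
  \<open>0\<close> and \<open>b\<close>, at distance at most \<open>2\<tau>\<close> from \<open>b\<close>.
\<close>

lemma soft_threshold_error:
  assumes "0 \<le> \<tau>"
  shows "\<bar>soft_threshold \<tau> (b + d + \<xi>) - b\<bar> \<le> \<bar>d\<bar> + min \<bar>b\<bar> (2 * \<tau>) + max 0 (\<bar>\<xi>\<bar> - \<tau>)"
  using assms unfolding soft_threshold_def by (smt (verit))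

lemma measurable_soft_threshold [measurable]: "soft_threshold \<tau> \<in> borel_measurable borel"
  unfolding soft_threshold_def by measurable


section \<open>Geometric sums over levels\<close>

lemma powr_power_two: "(2 powr c) ^ j = (2::real) powr (real j * c)"
  by (simp add: powr_power)

lemma two_powr_neg:
  fixes t :: real
  assumes "0 < t"
  shows "0 \<le> 2 powr (- t)" "2 powr (- t) < (1::real)"
  using powr_less_mono[of "- t" 0 2] assms by simp_all

lemma min_one_le_powr:
  fixes u s :: real
  assumes "0 \<le> u" "0 < s" "s \<le> 1"
  shows "min 1 u \<le> u powr s"
proof (cases "u \<le> 1")
  case True
  then have "u powr 1 \<le> u powr s"
    using assms by (intro powr_mono') auto
  then show ?thesis using True assms by simp
next
  case False
  then show ?thesis using assms by (simp add: ge_one_powr_ge_zero)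
qed

lemma power_of_two_crossing:
  fixes u :: real
  assumes "1 \<le> u"
  obtains K :: nat where "\<And>j. j < K \<longleftrightarrow> 2 ^ j \<le> u" "2 ^ K \<le> 2 * u"
proof -
  define K where "K = (LEAST k. u < 2 ^ k)"
  have "\<exists>k. u < 2 ^ k" using real_arch_pow[of 2 u] by auto
  then have K: "u < 2 ^ K" unfolding K_def by (rule LeastI_ex)
  have lt: "2 ^ j \<le> u" if "j < K" for j
    using not_less_Least[of j "\<lambda>k. u < 2 ^ k"] that unfolding K_def by simp
  have ge: "j < K" if "2 ^ j \<le> u" for j
  proof (rule ccontr)
    assume "\<not> j < K"
    then have "(2::real) ^ K \<le> 2 ^ j" by (intro power_increasing) auto
    then show False using K that by linarith
  qed
  have "0 < K" using ge[of 0] assms by simp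
  then have "2 ^ (K - 1) \<le> u" by (intro lt) simp
  moreover have "(2::real) ^ K = 2 * 2 ^ (K - 1)"
    using \<open>0 < K\<close> by (cases K) auto
  ultimately have "2 ^ K \<le> 2 * u" by simp
  with lt ge show ?thesis by (intro that) blast+
qed

lemma geometric_tail_bound:
  fixes a :: real
  assumes "0 \<le> a" "a < 1" "finite S" "\<And>j. j \<in> S \<Longrightarrow> k \<le> j"
  shows "(\<Sum>j\<in>S. a ^ j) \<le> a ^ k / (1 - a)"
proof -
  have s: "summable (\<lambda>j. a ^ (j + k))"
    using assms by (simp add: power_add summable_mult2)
  have "(\<Sum>j\<in>S. a ^ j) = (\<Sum>i\<in>(\<lambda>j. j - k) ` S. a ^ (i + k))"
  proof (subst sum.reindex)
    show "inj_on (\<lambda>j. j - k) S"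
      using assms(4) by (auto simp: inj_on_def) (metis le_add_diff_inverse2)
  qed (use assms(4) in \<open>auto intro!: sum.cong\<close>)
  also have "\<dots> \<le> (\<Sum>i. a ^ (i + k))"
    using assms by (intro sum_le_suminf s) auto
  also have "\<dots> = a ^ k / (1 - a)"
    using suminf_mult2[of "\<lambda>i. a ^ i" "a ^ k"] suminf_geometric[of a] assms
    by (simp add: power_add)
  finally show ?thesis .
qed

text \<open>
  The two arguments of the minimum are of the same order at the level \<open>K\<close> with \<open>2\<^sup>K \<approx> u\<close>, where both are
  about \<open>u\<^bsup>-t\<^esup>\<close>. Below \<open>K\<close> the second one is a growing geometric sequence, from \<open>K\<close> on
  the first one is a decaying geometric sequence, and a geometric sum is comparable with its largest term.
\<close>

lemma balanced_geometric_sum: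
  fixes t u c b :: real
  assumes "0 < t" "1 \<le> u" "0 \<le> b" "0 \<le> c" "finite S"
  shows "(\<Sum>j\<in>S. min (b * 2 powr (- real j * t)) (c * u powr (- t - 1/2) * 2 powr (real j / 2)))
           \<le> (b / (1 - 2 powr (- t)) + c * sqrt 2 / (sqrt 2 - 1)) * u powr (- t)"
proof -
  obtain K :: nat where K: "\<And>j. j < K \<longleftrightarrow> 2 ^ j \<le> u" "2 ^ K \<le> 2 * u"
    using power_of_two_crossing[OF assms(2)] by blast
  let ?x = "\<lambda>j. b * 2 powr (- real j * t)"
  let ?y = "\<lambda>j. c * u powr (- t - 1/2) * 2 powr (real j / 2)"
  define a :: real where "a = 2 powr (- t)"
  have a: "0 \<le> a" "a < 1" unfolding a_def using assms by (auto simp: powr_less_one)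
  have pa: "2 powr (- real j * t) = a ^ j" for j
    unfolding a_def by (simp add: powr_powr flip: powr_realpow) (simp add: algebra_simps)
  have p2: "2 powr (real j / 2) = sqrt 2 ^ j" for j
    by (simp add: powr_half_sqrt[symmetric] powr_powr flip: powr_realpow)
  have u: "u < 2 ^ K" using K(1)[of K] by simp
  have "(\<Sum>j\<in>S. min (?x j) (?y j))
      = (\<Sum>j\<in>S \<inter> {K..}. min (?x j) (?y j)) + (\<Sum>j\<in>S \<inter> {..<K}. min (?x j) (?y j))"
    using assms by (subst sum.union_disjoint[symmetric]) (auto intro!: sum.cong)
  also have "\<dots> \<le> (\<Sum>j\<in>S \<inter> {K..}. ?x j) + (\<Sum>j\<in>{..<K}. ?y j)"
    using assms by (intro add_mono sum_mono order.trans[OF sum_mono sum_mono2]) auto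
  also have "(\<Sum>j\<in>S \<inter> {K..}. ?x j) \<le> b * (a ^ K / (1 - a))"
    using assms geometric_tail_bound[OF a, of "S \<inter> {K..}" K]
    by (simp only: pa flip: sum_distrib_left) (intro mult_left_mono, auto)
  also have "\<dots> \<le> b * (u powr (- t) / (1 - a))"
  proof -
    have "a ^ K = (2 ^ K) powr (- t)"
      unfolding a_def by (simp add: powr_powr mult.commute flip: powr_realpow)
    also have "\<dots> \<le> u powr (- t)" using u assms by (intro powr_mono2') auto
    finally show ?thesis using a assms by (intro mult_left_mono divide_right_mono) auto
  qed
  also have "(\<Sum>j<K. ?y j) = c * u powr (- t - 1/2) * ((sqrt 2 ^ K - 1) / (sqrt 2 - 1))"
    by (simp only: p2 flip: sum_distrib_left) (simp add: geometric_sum)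
  also have "\<dots> \<le> c * u powr (- t - 1/2) * (sqrt 2 * u powr (1/2) / (sqrt 2 - 1))"
  proof -
    have "sqrt 2 ^ K = sqrt (2 ^ K)" by (simp add: real_sqrt_power)
    also have "\<dots> \<le> sqrt (2 * u)" using K(2) by simp
    also have "\<dots> = sqrt 2 * u powr (1/2)" using assms by (simp add: real_sqrt_mult powr_half_sqrt)
    finally show ?thesis using assms by (intro mult_left_mono divide_right_mono) auto
  qed
  also have "\<dots> = c * sqrt 2 / (sqrt 2 - 1) * (u powr (- t - 1/2) * u powr (1/2))" by simp
  also have "u powr (- t - 1/2) * u powr (1/2) = u powr (- t)"
    by (simp flip: powr_add)
  finally show ?thesis by (simp add: a_def algebra_simps)
qed


section \<open>The rate\<close>

lemma one_le_ln: "3 \<le> n \<Longrightarrow> 1 \<le> ln (real n)"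
  using exp_le by (subst ln_ge_iff) (auto intro: order.trans)

lemma rate_eq_powr:
  assumes "3 \<le> n"
  shows "rate n t = (real n / ln (real n)) powr (- (t / (2 * t + 1)))"
proof -
  have "ln (real n) / real n = (real n / ln (real n)) powr (- 1)"
    using one_le_ln[OF assms] by (simp add: powr_minus_divide)
  then show ?thesis unfolding rate_def by (simp only: powr_powr) simp
qed

lemma powr_minus_le_rate:
  assumes "3 \<le> n" "0 < t" "t / (2 * t + 1) \<le> p"
  shows "real n powr (- p) \<le> rate n t"
proof -
  have "real n powr (- p) \<le> real n powr (- (t / (2 * t + 1)))"
    using assms by (intro powr_mono) auto
  also have "\<dots> \<le> (real n / ln (real n)) powr (- (t / (2 * t + 1)))"
    using assms one_le_ln[OF assms(1)]
    by (intro powr_mono2') (auto simp: divide_le_eq mult_le_cancel_left1)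
  finally show ?thesis by (simp add: rate_eq_powr[OF assms(1)])
qed


section \<open>Coefficients of the step function through the data\<close>

lemma integral_partition_unit_interval:
  fixes g :: "real \<Rightarrow> real"
  assumes "g integrable_on {0..1}" "m \<le> n" "0 < n"
  shows "(\<Sum>k\<in>{1..m}. integral {(real k - 1) / real n..real k / real n} g) = integral {0..real m / real n} g"
  using assms(2)
proof (induction m)
  case (Suc m)
  have "g integrable_on {0..real (Suc m) / real n}"
    using Suc.prems assms by (intro integrable_on_subinterval[OF assms(1)]) (auto simp: field_simps)
  then have "integral {0..real m / real n} g + integral {real m / real n..real (Suc m) / real n} g
        = integral {0..real (Suc m) / real n} g"
    using assms by (intro Henstock_Kurzweil_Integration.integral_combine) (auto simp: field_simps)
  then show ?case using Suc by simp
qed simp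

lemma cell_subset:
  assumes "k \<in> {1..n}"
  shows "{(real k - 1) / real n..real k / real n} \<subseteq> {0..1}"
  using assms by (auto simp: field_simps)

text \<open>
  Cauchy--Schwarz against the constant function: expand the nonnegative integral of
  \<open>((b - a) g - \<integral>g)\<^sup>2\<close>.
\<close>

lemma integral_square_le:
  fixes g :: "real \<Rightarrow> real"
  assumes "continuous_on {a..b} g" "a < b"
  shows "(integral {a..b} g)\<^sup>2 \<le> (b - a) * integral {a..b} (\<lambda>x. (g x)\<^sup>2)"
proof -
  define \<mu> where "\<mu> = integral {a..b} g"
  define L where "L = b - a"
  have *: "(g has_integral \<mu>) {a..b}" "((\<lambda>x. (g x)\<^sup>2) has_integral integral {a..b} (\<lambda>x. (g x)\<^sup>2)) {a..b}"
    unfolding \<mu>_def using assms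
    by (auto intro!: integrable_integral integrable_continuous_interval continuous_intros)
  have "((\<lambda>x. L\<^sup>2 * (g x)\<^sup>2 - (2 * L * \<mu>) * g x + \<mu>\<^sup>2) has_integral
      L\<^sup>2 * integral {a..b} (\<lambda>x. (g x)\<^sup>2) - (2 * L * \<mu>) * \<mu> + L * \<mu>\<^sup>2) {a..b}"
    using has_integral_const_real[of "\<mu>\<^sup>2" a b] assms
    by (intro has_integral_add has_integral_diff has_integral_mult_right *) (simp add: L_def)
  moreover have "(\<lambda>x. L\<^sup>2 * (g x)\<^sup>2 - (2 * L * \<mu>) * g x + \<mu>\<^sup>2) = (\<lambda>x. (L * g x - \<mu>)\<^sup>2)"
    by (simp add: fun_eq_iff power2_eq_square algebra_simps)
  ultimately have "((\<lambda>x. (L * g x - \<mu>)\<^sup>2) has_integral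
      L\<^sup>2 * integral {a..b} (\<lambda>x. (g x)\<^sup>2) - (2 * L * \<mu>) * \<mu> + L * \<mu>\<^sup>2) {a..b}"
    by simp
  then have "0 \<le> L\<^sup>2 * integral {a..b} (\<lambda>x. (g x)\<^sup>2) - (2 * L * \<mu>) * \<mu> + L * \<mu>\<^sup>2"
    by (rule has_integral_nonneg) simp
  also have "\<dots> = L * (L * integral {a..b} (\<lambda>x. (g x)\<^sup>2) - \<mu>\<^sup>2)"
    by (simp add: power2_eq_square algebra_simps)
  finally show ?thesis using assms by (auto simp: zero_le_mult_iff L_def \<mu>_def)
qed

text \<open>
  The coefficient with respect to \<open>g\<close> of the step function that equals \<open>y k\<close> on
  the \<open>k\<close>-th of \<open>n\<close> intervals of equal length. Compared with the Riemann sum of \<open>y k * g (k/n)\<close>, integrating \<open>g\<close>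
  exactly leaves the oscillation of the data as the only source of bias.
\<close>

definition step_coef :: "nat \<Rightarrow> (real \<Rightarrow> real) \<Rightarrow> (nat \<Rightarrow> real) \<Rightarrow> real" where
  "step_coef n g y = (\<Sum>k\<in>{1..n}. y k * integral {(real k - 1) / real n..real k / real n} g)"

lemma step_coef_observations:
  "step_coef n g (observations n f \<epsilon>) = step_coef n g (\<lambda>k. f (real k / real n)) + step_coef n g \<epsilon>"
  unfolding step_coef_def observations_def sum.distrib[symmetric]
  by (intro sum.cong) (auto simp: algebra_simps)

text \<open>
  On every cell the step function through the values \<open>f(k/n)\<close> differs from \<open>f\<close> by at most the
  oscillation \<open>h\<close>; the rest is the \<open>L\<^sup>1\<close> norm of \<open>g\<close>.
\<close>

lemma step_coef_bias:
  assumes f: "continuous_on {0..1} f" and g: "continuous_on {0..1} g" and "0 < n"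
    and h: "\<And>x y. x \<in> {0..1} \<Longrightarrow> y \<in> {0..1} \<Longrightarrow> \<bar>x - y\<bar> \<le> 1 / real n \<Longrightarrow> \<bar>f x - f y\<bar> \<le> h"
  shows "\<bar>step_coef n g (\<lambda>k. f (real k / real n)) - integral {0..1} (\<lambda>x. g x * f x)\<bar>
           \<le> h * integral {0..1} (\<lambda>x. \<bar>g x\<bar>)"
proof -
  let ?I = "\<lambda>k. {(real k - 1) / real n..real k / real n}"
  have "step_coef n g (\<lambda>k. f (real k / real n)) - integral {0..1} (\<lambda>x. g x * f x)
     = (\<Sum>k\<in>{1..n}. f (real k / real n) * integral (?I k) g)
         - (\<Sum>k\<in>{1..n}. integral (?I k) (\<lambda>x. g x * f x))"
    unfolding step_coef_def using assms
    by (subst integral_partition_unit_interval)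
       (auto intro!: integrable_continuous_interval continuous_intros)
  also have "\<dots> = (\<Sum>k\<in>{1..n}. integral (?I k) (\<lambda>x. (f (real k / real n) - f x) * g x))"
    unfolding sum_subtractf[symmetric]
  proof (intro sum.cong refl)
    fix k assume "k \<in> {1..n}"
    then have [continuous_intros]: "continuous_on (?I k) f" "continuous_on (?I k) g"
      using cell_subset f g continuous_on_subset by metis+
    show "f (real k / real n) * integral (?I k) g - integral (?I k) (\<lambda>x. g x * f x)
        = integral (?I k) (\<lambda>x. (f (real k / real n) - f x) * g x)"
      by (subst integral_mult_right[symmetric], subst integral_diff[symmetric])
         (auto intro!: integrable_continuous_interval continuous_intros simp: algebra_simps)
  qed
  also have "\<bar>\<dots>\<bar> \<le> (\<Sum>k\<in>{1..n}. integral (?I k) (\<lambda>x. h * \<bar>g x\<bar>))"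
  proof (intro order.trans[OF sum_abs] sum_mono)
    fix k assume k: "k \<in> {1..n}"
    then have [continuous_intros]: "continuous_on (?I k) f" "continuous_on (?I k) g"
      using cell_subset f g continuous_on_subset by metis+
    have "norm (integral (?I k) (\<lambda>x. (f (real k / real n) - f x) * g x)) \<le> integral (?I k) (\<lambda>x. h * \<bar>g x\<bar>)"
    proof (intro integral_norm_bound_integral integrable_continuous_interval continuous_intros)
      fix x assume x: "x \<in> ?I k"
      have "x \<in> {0..1}" using x cell_subset[OF k] by blast
      moreover have "real k / real n \<in> {0..1}" using k by auto
      moreover have "\<bar>real k / real n - x\<bar> \<le> 1 / real n" using x by (auto simp: diff_divide_distrib)
      ultimately show "norm ((f (real k / real n) - f x) * g x) \<le> h * \<bar>g x\<bar>"
        by (simp add: abs_mult) (intro mult_right_mono h, auto)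
    qed
    then show "\<bar>integral (?I k) (\<lambda>x. (f (real k / real n) - f x) * g x)\<bar> \<le> integral (?I k) (\<lambda>x. h * \<bar>g x\<bar>)"
      by simp
  qed
  also have "\<dots> = integral {0..1} (\<lambda>x. h * \<bar>g x\<bar>)"
    using assms by (subst integral_partition_unit_interval)
       (auto intro!: integrable_continuous_interval continuous_intros)
  finally show ?thesis by simp
qed

text \<open>
  The left-hand side, times \<open>\<sigma>\<^sup>2\<close>, is the variance of the empirical coefficient. Cauchy--Schwarz on each cell
  gains the factor \<open>1/n\<close>.
\<close>

lemma step_weights_sum_squares:
  assumes g: "continuous_on {0..1} g" and "0 < n"
  shows "(\<Sum>k\<in>{1..n}. (integral {(real k - 1) / real n..real k / real n} g)\<^sup>2)
           \<le> integral {0..1} (\<lambda>x. (g x)\<^sup>2) / real n"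
proof -
  let ?I = "\<lambda>k. {(real k - 1) / real n..real k / real n}"
  have "(integral (?I k) g)\<^sup>2 \<le> integral (?I k) (\<lambda>x. (g x)\<^sup>2) / real n" if "k \<in> {1..n}" for k
    using integral_square_le[of "(real k - 1) / real n" "real k / real n" g] that \<open>0 < n\<close>
      continuous_on_subset[OF g cell_subset[OF that]]
    by (auto simp: divide_simps)
  then have "(\<Sum>k\<in>{1..n}. (integral (?I k) g)\<^sup>2) \<le> (\<Sum>k\<in>{1..n}. integral (?I k) (\<lambda>x. (g x)\<^sup>2) / real n)"
    by (rule sum_mono)
  also have "\<dots> = integral {0..1} (\<lambda>x. (g x)\<^sup>2) / real n"
    using assms unfolding sum_divide_distrib[symmetric] 
    by (subst integral_partition_unit_interval)
       (auto intro!: integrable_continuous_interval continuous_intros)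
  finally show ?thesis .
qed

lemma measurable_step_coef [measurable]:
  "step_coef n g \<in> borel_measurable (\<Pi>\<^sub>M i\<in>{1..n}. borel)"
  unfolding step_coef_def by measurable


section \<open>Gaussian noise\<close>

lemma gaussian_mgf:
  assumes "0 < \<sigma>"
  shows "(\<integral>\<^sup>+x. ennreal (exp (a * x)) \<partial>density lborel (\<lambda>x. ennreal (normal_density 0 \<sigma> x)))
           = ennreal (exp (\<sigma>\<^sup>2 * a\<^sup>2 / 2))"
proof -
  \<comment> \<open>completing the square turns the tilted density into a shifted one\<close>
  have eq: "normal_density 0 \<sigma> x * exp (a * x) = exp (\<sigma>\<^sup>2 * a\<^sup>2 / 2) * normal_density (a * \<sigma>\<^sup>2) \<sigma> x" for x
  proof -
    have "- (x - 0)\<^sup>2 / (2 * \<sigma>\<^sup>2) + a * x = \<sigma>\<^sup>2 * a\<^sup>2 / 2 + (- (x - a * \<sigma>\<^sup>2)\<^sup>2 / (2 * \<sigma>\<^sup>2))"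
      using assms by (simp add: field_simps power2_eq_square)
    then show ?thesis unfolding normal_density_def by (simp add: mult.assoc flip: exp_add)
  qed
  have "(\<integral>\<^sup>+x. ennreal (exp (a * x)) \<partial>density lborel (\<lambda>x. ennreal (normal_density 0 \<sigma> x)))
      = (\<integral>\<^sup>+x. ennreal (exp (\<sigma>\<^sup>2 * a\<^sup>2 / 2)) * ennreal (normal_density (a * \<sigma>\<^sup>2) \<sigma> x) \<partial>lborel)"
    by (subst nn_integral_density) (auto simp: eq simp flip: ennreal_mult)
  also have "\<dots> = ennreal (exp (\<sigma>\<^sup>2 * a\<^sup>2 / 2)) * (\<integral>\<^sup>+x. ennreal (normal_density (a * \<sigma>\<^sup>2) \<sigma> x) \<partial>lborel)"
    by (rule nn_integral_cmult) simp
  also have "(\<integral>\<^sup>+x. ennreal (normal_density (a * \<sigma>\<^sup>2) \<sigma> x) \<partial>lborel) = 1"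
    using assms by (subst nn_integral_eq_integral) auto
  finally show ?thesis by simp
qed

lemma noise_product_sigma_finite:
  assumes "0 < \<sigma>"
  shows "product_sigma_finite (\<lambda>i::nat. density lborel (\<lambda>x. ennreal (normal_density 0 \<sigma> x)))"
  using assms prob_space_normal_density[of \<sigma> 0]
  by (auto simp: product_sigma_finite_def intro: prob_space_imp_sigma_finite)

lemma sets_noise: "sets (noise \<sigma> n) = sets (\<Pi>\<^sub>M i\<in>{1..n}. borel)"
  unfolding noise_def by (intro sets_PiM_cong) auto

lemma measurable_noise: "measurable (noise \<sigma> n) M = measurable (\<Pi>\<^sub>M i\<in>{1..n}. borel) M"
  by (intro measurable_cong_sets sets_noise refl)

lemma noise_mgf:
  assumes "0 < \<sigma>"
  shows "(\<integral>\<^sup>+\<epsilon>. ennreal (exp (\<Sum>k\<in>{1..n}. a k * \<epsilon> k)) \<partial>noise \<sigma> n)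
           = ennreal (exp (\<sigma>\<^sup>2 * (\<Sum>k\<in>{1..n}. (a k)\<^sup>2) / 2))"
proof -
  interpret product_sigma_finite "\<lambda>i::nat. density lborel (\<lambda>x. ennreal (normal_density 0 \<sigma> x))"
    using assms by (rule noise_product_sigma_finite)
  have "(\<integral>\<^sup>+\<epsilon>. ennreal (exp (\<Sum>k\<in>{1..n}. a k * \<epsilon> k)) \<partial>noise \<sigma> n)
      = (\<integral>\<^sup>+\<epsilon>. (\<Prod>k\<in>{1..n}. ennreal (exp (a k * \<epsilon> k))) \<partial>noise \<sigma> n)"
    by (simp add: exp_sum prod_ennreal)
  also have "\<dots> = (\<Prod>k\<in>{1..n}. ennreal (exp (\<sigma>\<^sup>2 * (a k)\<^sup>2 / 2)))"
    unfolding noise_def by (subst product_nn_integral_prod) (auto simp: gaussian_mgf[OF assms])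
  also have "\<dots> = ennreal (exp (\<sigma>\<^sup>2 * (\<Sum>k\<in>{1..n}. (a k)\<^sup>2) / 2))"
    by (simp add: prod_ennreal sum_distrib_left sum_divide_distrib flip: exp_sum)
  finally show ?thesis .
qed

lemma emeasure_noise_space: "0 < \<sigma> \<Longrightarrow> emeasure (noise \<sigma> n) (space (noise \<sigma> n)) = 1"
  using noise_mgf[of \<sigma> n "\<lambda>_. 0"] by simp

text \<open>
  The Chernoff method for the expected excess over a level: \<open>max 0 z \<le> exp (\<kappa> z) / \<kappa>\<close>, applied to both
  signs of the Gaussian sum. The parameter \<open>\<kappa>\<close> is left free, to be optimised for the given \<open>\<tau>\<close>.
\<close>

lemma gaussian_excess:
  assumes "0 < \<sigma>" "0 < \<kappa>" and v: "(\<Sum>k\<in>{1..n}. (w k)\<^sup>2) \<le> v"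
  shows "(\<integral>\<^sup>+\<epsilon>. ennreal (max 0 (\<bar>\<Sum>k\<in>{1..n}. \<epsilon> k * w k\<bar> - \<tau>)) \<partial>noise \<sigma> n)
           \<le> ennreal (2 / \<kappa> * exp (\<sigma>\<^sup>2 * \<kappa>\<^sup>2 * v / 2 - \<kappa> * \<tau>))"
proof -
  let ?\<xi> = "\<lambda>\<epsilon>. \<Sum>k\<in>{1..n}. \<epsilon> k * w k"
  let ?c = "exp (- \<kappa> * \<tau>) / \<kappa>"
  have [measurable]: "(\<lambda>\<epsilon>. exp (\<Sum>k\<in>{1..n}. a k * \<epsilon> k)) \<in> borel_measurable (noise \<sigma> n)" for a
    unfolding measurable_noise by measurable
  have pw: "max 0 (\<bar>x\<bar> - \<tau>) \<le> ?c * (exp (\<kappa> * x) + exp (- \<kappa> * x))" for x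
  proof -
    have "\<kappa> * (\<bar>x\<bar> - \<tau>) \<le> exp (\<kappa> * (\<bar>x\<bar> - \<tau>))"
      using exp_ge_add_one_self[of "\<kappa> * (\<bar>x\<bar> - \<tau>)"] by linarith
    then have "\<kappa> * max 0 (\<bar>x\<bar> - \<tau>) \<le> exp (\<kappa> * (\<bar>x\<bar> - \<tau>))"
      by (auto simp: max_def)
    also have "\<dots> = exp (- \<kappa> * \<tau>) * exp (\<kappa> * \<bar>x\<bar>)" by (simp add: algebra_simps flip: exp_add)
    also have "\<dots> \<le> exp (- \<kappa> * \<tau>) * (exp (\<kappa> * x) + exp (- \<kappa> * x))"
      by (intro mult_left_mono) (auto simp: abs_if)
    finally have "max 0 (\<bar>x\<bar> - \<tau>) \<le> (exp (- \<kappa> * \<tau>) * (exp (\<kappa> * x) + exp (- \<kappa> * x))) / \<kappa>"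
      by (subst pos_le_divide_eq[OF \<open>0 < \<kappa>\<close>]) (simp add: mult.commute)
    then show ?thesis by simp
  qed
  have mgf: "(\<integral>\<^sup>+\<epsilon>. ennreal (exp (s * ?\<xi> \<epsilon>)) \<partial>noise \<sigma> n) \<le> ennreal (exp (\<sigma>\<^sup>2 * \<kappa>\<^sup>2 * v / 2))"
    if "s\<^sup>2 = \<kappa>\<^sup>2" for s
  proof -
    have "(\<integral>\<^sup>+\<epsilon>. ennreal (exp (s * ?\<xi> \<epsilon>)) \<partial>noise \<sigma> n)
        = ennreal (exp (\<sigma>\<^sup>2 * (\<Sum>k\<in>{1..n}. (s * w k)\<^sup>2) / 2))"
      using noise_mgf[OF assms(1), of n "\<lambda>k. s * w k"]
      by (simp add: sum_distrib_left algebra_simps)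
    also have "(\<Sum>k\<in>{1..n}. (s * w k)\<^sup>2) = \<kappa>\<^sup>2 * (\<Sum>k\<in>{1..n}. (w k)\<^sup>2)"
      using that by (simp add: power_mult_distrib sum_distrib_left)
    also have "ennreal (exp (\<sigma>\<^sup>2 * (\<kappa>\<^sup>2 * (\<Sum>k\<in>{1..n}. (w k)\<^sup>2)) / 2)) \<le> ennreal (exp (\<sigma>\<^sup>2 * \<kappa>\<^sup>2 * v / 2))"
      using mult_left_mono[OF v, of "\<sigma>\<^sup>2 * \<kappa>\<^sup>2"] by (intro ennreal_leI) (simp add: mult.assoc)
    finally show ?thesis .
  qed
  have meas: "(\<lambda>\<epsilon>. ennreal (exp (s * ?\<xi> \<epsilon>))) \<in> borel_measurable (noise \<sigma> n)" for s
    unfolding measurable_noise by measurable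
  have "(\<integral>\<^sup>+\<epsilon>. ennreal (max 0 (\<bar>?\<xi> \<epsilon>\<bar> - \<tau>)) \<partial>noise \<sigma> n)
     \<le> (\<integral>\<^sup>+\<epsilon>. ennreal ?c * (ennreal (exp (\<kappa> * ?\<xi> \<epsilon>)) + ennreal (exp (- \<kappa> * ?\<xi> \<epsilon>))) \<partial>noise \<sigma> n)"
    using pw \<open>0 < \<kappa>\<close>
    by (intro nn_integral_mono) (auto simp flip: ennreal_plus ennreal_mult intro!: ennreal_leI)
  also have "\<dots> = ennreal ?c * ((\<integral>\<^sup>+\<epsilon>. ennreal (exp (\<kappa> * ?\<xi> \<epsilon>)) \<partial>noise \<sigma> n)
                               + (\<integral>\<^sup>+\<epsilon>. ennreal (exp (- \<kappa> * ?\<xi> \<epsilon>)) \<partial>noise \<sigma> n))"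
    by (subst nn_integral_cmult[OF borel_measurable_add[OF meas meas]], subst nn_integral_add[OF meas meas]) simp
  also have "\<dots> \<le> ennreal ?c * (ennreal (exp (\<sigma>\<^sup>2 * \<kappa>\<^sup>2 * v / 2)) + ennreal (exp (\<sigma>\<^sup>2 * \<kappa>\<^sup>2 * v / 2)))"
    by (intro mult_left_mono add_mono mgf) auto
  also have "\<dots> = ennreal (2 / \<kappa> * exp (\<sigma>\<^sup>2 * \<kappa>\<^sup>2 * v / 2 - \<kappa> * \<tau>))"
    using \<open>0 < \<kappa>\<close> by (simp flip: ennreal_plus ennreal_mult) (simp add: field_simps flip: exp_add)
  finally show ?thesis .
qed


section \<open>Measurability of the sup-norm loss\<close>

text \<open>
  The set \<open>Q\<close> is dense in the unit interval and therefore does not depend on the functions, so that the loss of an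
  estimator with continuous realisations is a supremum of countably many measurable functions.
\<close>

lemma sup_dist_countable:
  obtains Q :: "real set" where "countable Q" "Q \<noteq> {}" "Q \<subseteq> {0..1}"
    "\<And>g f. continuous_on {0..1} g \<Longrightarrow> continuous_on {0..1} f \<Longrightarrow>
       sup_dist g f = (SUP x\<in>Q. ennreal \<bar>g x - f x\<bar>)"
proof -
  obtain Q :: "real set" where Q: "countable Q" "Q \<subseteq> {0..1}" "{0..1} \<subseteq> closure Q"
    using separable[of "{0..1::real}"] by blast
  have cl: "closure Q = {0..1}" using Q closure_minimal[of Q "{0..1}"] by auto
  have "sup_dist g f = (SUP x\<in>Q. ennreal \<bar>g x - f x\<bar>)"
    if gf: "continuous_on {0..1} g" "continuous_on {0..1} f" for g f
  proof (rule antisym)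
    let ?S = "SUP x\<in>Q. ennreal \<bar>g x - f x\<bar>"
    show "sup_dist g f \<le> ?S"
    proof (cases ?S)
      case top
      show ?thesis unfolding top by simp
    next
      case (real r)
      have "\<bar>g x - f x\<bar> \<le> r" if "x \<in> {0..1}" for x
      proof (rule continuous_le_on_closure[where f = "\<lambda>x. \<bar>g x - f x\<bar>"])
        show "continuous_on (closure Q) (\<lambda>x. \<bar>g x - f x\<bar>)"
          unfolding cl by (intro continuous_intros gf)
        show "x \<in> closure Q" using that cl by simp
        fix z assume "z \<in> Q"
        then have "ennreal \<bar>g z - f z\<bar> \<le> ?S" by (rule SUP_upper)
        then show "\<bar>g z - f z\<bar> \<le> r" using real by simp
      qed
      then show ?thesis unfolding sup_dist_def real by (intro SUP_least ennreal_leI) auto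
    qed
    show "?S \<le> sup_dist g f"
      unfolding sup_dist_def using Q by (intro SUP_subset_mono) auto
  qed
  moreover have "Q \<noteq> {}" using cl by auto
  ultimately show ?thesis using Q by (intro that) auto
qed

lemma estimatorI:
  assumes meas: "\<And>x. x \<in> {0..1} \<Longrightarrow> (\<lambda>y. T y x) \<in> borel_measurable (\<Pi>\<^sub>M i\<in>{1..n}. borel)"
    and cont: "\<And>y. continuous_on {0..1} (T y)"
  shows "estimator n T"
  unfolding estimator_def
proof (intro conjI allI impI ballI meas)
  fix f :: "real \<Rightarrow> real" assume f: "continuous_on {0..1} f"
  obtain Q :: "real set" where Q: "countable Q" "Q \<noteq> {}" "Q \<subseteq> {0..1}"
    "\<And>g f. continuous_on {0..1} g \<Longrightarrow> continuous_on {0..1} f \<Longrightarrow>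
       sup_dist g f = (SUP x\<in>Q. ennreal \<bar>g x - f x\<bar>)"
    using sup_dist_countable by blast
  have "(\<lambda>y. sup_dist (T y) f) = (\<lambda>y. SUP x\<in>Q. ennreal \<bar>T y x - f x\<bar>)"
    using Q(4)[OF cont f] by auto
  also have "\<dots> \<in> borel_measurable (\<Pi>\<^sub>M i\<in>{1..n}. borel)"
  proof (rule borel_measurable_SUP[OF Q(1)])
    fix x assume "x \<in> Q"
    then have [measurable]: "(\<lambda>y. T y x) \<in> borel_measurable (\<Pi>\<^sub>M i\<in>{1..n}. borel)"
      using Q meas by blast
    show "(\<lambda>y. ennreal \<bar>T y x - f x\<bar>) \<in> borel_measurable (\<Pi>\<^sub>M i\<in>{1..n}. borel)" by measurable
  qed
  finally show "(\<lambda>y. sup_dist (T y) f) \<in> borel_measurable (\<Pi>\<^sub>M i\<in>{1..n}. borel)" .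
qed


section \<open>Localised Lipschitz bases\<close>

lemma sum_locally_supported:
  fixes h :: "'b \<Rightarrow> real"
  assumes "finite S" "{i \<in> S. h i \<noteq> 0} \<subseteq> T" "finite T" "real (card T) \<le> A" "\<And>i. i \<in> S \<Longrightarrow> h i \<le> M" "0 \<le> M"
  shows "(\<Sum>i\<in>S. h i) \<le> A * M"
proof -
  have "(\<Sum>i\<in>S. h i) = (\<Sum>i | i \<in> S \<and> h i \<noteq> 0. h i)"
    using assms(1) by (intro sum.mono_neutral_right) auto
  also have "\<dots> \<le> real (card {i \<in> S. h i \<noteq> 0}) * M"
    using assms(5) by (intro sum_bounded_above) auto
  also have "\<dots> \<le> A * M"
    using assms card_mono[OF assms(3,2)] by (intro mult_right_mono) auto
  finally show ?thesis .
qed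

lemma L2_inner_continuous:
  assumes "continuous_on {0..1} g" "continuous_on {0..1} f"
  shows "L2_inner {0..1} g f = integral {0..1} (\<lambda>x. g x * f x)"
  unfolding L2_inner_def
  by (intro set_borel_integral_eq_integral borel_integrable_atLeastAtMost' continuous_intros assms)

lemma L2_fun_continuous:
  assumes "continuous_on {0..1} f"
  shows "L2_fun {0..1} f"
  unfolding L2_fun_def set_borel_measurable_def
  using assms by (auto intro!: borel_measurable_continuous_on_indicator borel_integrable_atLeastAtMost' continuous_intros
     simp del: real_scaleR_def)

text \<open>
  An orthonormal basis whose members are grouped into levels, with the scaling behaviour of wavelets: on level \<open>j\<close>
  there are \<open>O(2\<^sup>j)\<close> functions of height \<open>O(2\<^bsup>j/2\<^esup>)\<close> and slope \<open>O(2\<^bsup>3j/2\<^esup>)\<close>, boundedly many of which are nonzero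
  at any given point. The bound on the \<open>L\<^sup>1\<close> norm is what functions of this height satisfy if their supports have
  length \<open>O(2\<^bsup>-j\<^esup>)\<close>.
  One constant \<open>C\<close> serves for all of them.
\<close>

locale local_lipschitz_basis =
  fixes I :: "'i set" and lev :: "'i \<Rightarrow> nat" and e :: "'i \<Rightarrow> real \<Rightarrow> real" and C :: real
  assumes C_ge_1: "1 \<le> C"
    and finite_level: "finite {i \<in> I. lev i = j}"
    and card_level: "real (card {i \<in> I. lev i = j}) \<le> C * 2 ^ j"
    and overlap: "x \<in> {0..1} \<Longrightarrow> real (card {i \<in> I. lev i = j \<and> e i x \<noteq> 0}) \<le> C"
    and bound: "i \<in> I \<Longrightarrow> x \<in> {0..1} \<Longrightarrow> \<bar>e i x\<bar> \<le> C * 2 powr (real (lev i) / 2)"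
    and lipschitz: "i \<in> I \<Longrightarrow> x \<in> {0..1} \<Longrightarrow> y \<in> {0..1} \<Longrightarrow>
          \<bar>e i x - e i y\<bar> \<le> C * 2 powr (real (lev i) / 2) * (2 ^ lev i * \<bar>x - y\<bar>)"
    and integral_abs: "i \<in> I \<Longrightarrow> integral {0..1} (\<lambda>x. \<bar>e i x\<bar>) \<le> C * 2 powr (- real (lev i) / 2)"
    and basis: "L2_orthonormal_basis {0..1} I e"
begin

definition coef :: "(real \<Rightarrow> real) \<Rightarrow> 'i \<Rightarrow> real" where
  "coef f i = L2_inner {0..1} (e i) f"

definition detail :: "(real \<Rightarrow> real) \<Rightarrow> nat \<Rightarrow> real \<Rightarrow> real" where
  "detail f j x = (\<Sum>i | i \<in> I \<and> lev i = j. coef f i * e i x)"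

lemma continuous_e [continuous_intros]:
  assumes "i \<in> I" shows "continuous_on {0..1} (e i)"
proof (rule lipschitz_on_continuous_on)
  show "(C * 2 powr (real (lev i) / 2) * 2 ^ lev i)-lipschitz_on {0..1} (e i)"
    using lipschitz[OF assms] C_ge_1 by (intro lipschitz_onI) (auto simp: dist_real_def mult.assoc)
qed

lemma finite_below: "finite {i \<in> I. lev i < K}"
proof -
  have "{i \<in> I. lev i < K} = (\<Union>j<K. {i \<in> I. lev i = j})" by auto
  then show ?thesis using finite_level by simp
qed

lemma sum_below_levels:
  "(\<Sum>i | i \<in> I \<and> lev i < K. F i) = (\<Sum>j<K. \<Sum>i | i \<in> I \<and> lev i = j. F i)"
proof -
  have "(\<Sum>j<K. \<Sum>i | i \<in> {i \<in> I. lev i < K} \<and> lev i = j. F i) = (\<Sum>i | i \<in> I \<and> lev i < K. F i)"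
    by (rule sum.group[OF finite_below]) auto
  moreover have "{i. i \<in> {i \<in> I. lev i < K} \<and> lev i = j} = {i. i \<in> I \<and> lev i = j}" if "j < K" for j
    using that by auto
  ultimately show ?thesis by simp
qed

lemma level_sum_bound:
  assumes "x \<in> {0..1}" "0 \<le> M" "\<And>i. i \<in> I \<Longrightarrow> lev i = j \<Longrightarrow> \<bar>c i\<bar> \<le> M"
  shows "(\<Sum>i | i \<in> I \<and> lev i = j. \<bar>c i\<bar> * \<bar>e i x\<bar>) \<le> C\<^sup>2 * M * 2 powr (real j / 2)"
proof -
  have "(\<Sum>i | i \<in> I \<and> lev i = j. \<bar>c i\<bar> * \<bar>e i x\<bar>) \<le> C * (M * (C * 2 powr (real j / 2)))"
  proof (rule sum_locally_supported)
    show "finite {i \<in> I. lev i = j \<and> e i x \<noteq> 0}"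
      by (rule finite_subset[OF _ finite_level[of j]]) auto
    show "\<bar>c i\<bar> * \<bar>e i x\<bar> \<le> M * (C * 2 powr (real j / 2))" if "i \<in> {i \<in> I. lev i = j}" for i
      using assms that bound[of i x] by (intro mult_mono) auto
  qed (use assms finite_level overlap C_ge_1 in auto)
  then show ?thesis by (simp add: power2_eq_square mult_ac)
qed

text \<open>
  The difference \<open>e i x - e i y\<close> is bounded by the height of \<open>e i\<close> as well as by its slope times \<open>\<bar>x - y\<bar>\<close>.
  Interpolating between the two bounds gives a Hoelder estimate of any order \<open>s \<le> 1\<close>.
\<close>

lemma level_sum_increment:
  assumes "x \<in> {0..1}" "y \<in> {0..1}" "0 \<le> M" "\<And>i. i \<in> I \<Longrightarrow> lev i = j \<Longrightarrow> \<bar>c i\<bar> \<le> M"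
    and s: "0 < s" "s \<le> 1"
  shows "(\<Sum>i | i \<in> I \<and> lev i = j. \<bar>c i\<bar> * \<bar>e i x - e i y\<bar>)
           \<le> 4 * C\<^sup>2 * M * 2 powr (real j / 2) * (2 ^ j * \<bar>x - y\<bar>) powr s"
proof -
  let ?B = "2 * C * 2 powr (real j / 2) * (2 ^ j * \<bar>x - y\<bar>) powr s"
  let ?T = "\<lambda>x. {i \<in> I. lev i = j \<and> e i x \<noteq> 0}"
  have fin: "finite (?T x)" for x
    by (rule finite_subset[OF _ finite_level[of j]]) auto
  have "(\<Sum>i | i \<in> I \<and> lev i = j. \<bar>c i\<bar> * \<bar>e i x - e i y\<bar>) \<le> (2 * C) * (M * ?B)"
  proof (rule sum_locally_supported)
    show "finite (?T x \<union> ?T y)" using fin by simp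
    have "card (?T x \<union> ?T y) \<le> card (?T x) + card (?T y)" by (rule card_Un_le)
    then show "real (card (?T x \<union> ?T y)) \<le> 2 * C"
      using overlap[OF assms(1), of j] overlap[OF assms(2), of j] by linarith
    show "\<bar>c i\<bar> * \<bar>e i x - e i y\<bar> \<le> M * ?B" if "i \<in> {i \<in> I. lev i = j}" for i
    proof (intro mult_mono)
      let ?W = "C * 2 powr (real j / 2)"
      have i: "i \<in> I" "lev i = j" using that by auto
      have "\<bar>e i x - e i y\<bar> \<le> \<bar>e i x\<bar> + \<bar>e i y\<bar>" by simp
      also have "\<dots> \<le> 2 * ?W * 1"
        using bound[OF i(1) assms(1)] bound[OF i(1) assms(2)] i by simp
      finally have 1: "\<bar>e i x - e i y\<bar> \<le> 2 * ?W * 1" .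
      have "\<bar>e i x - e i y\<bar> \<le> ?W * (2 ^ j * \<bar>x - y\<bar>)"
        using lipschitz[OF i(1) assms(1,2)] i by simp
      also have "\<dots> \<le> 2 * ?W * (2 ^ j * \<bar>x - y\<bar>)"
        using C_ge_1 by (intro mult_right_mono) auto
      finally have "\<bar>e i x - e i y\<bar> \<le> 2 * ?W * min 1 (2 ^ j * \<bar>x - y\<bar>)"
        using 1 by (auto simp: min_def)
      also have "\<dots> \<le> 2 * ?W * (2 ^ j * \<bar>x - y\<bar>) powr s"
        using C_ge_1 s by (intro mult_left_mono min_one_le_powr) auto
      finally show "\<bar>e i x - e i y\<bar> \<le> ?B" by simp
    qed (use assms that in auto)
  qed (use assms finite_level C_ge_1 in auto)
  then show ?thesis by (simp add: power2_eq_square mult_ac)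
qed


section \<open>Expansion of functions with decaying coefficients\<close>

lemma has_integral_e_e:
  assumes "i \<in> I" "k \<in> I"
  shows "((\<lambda>x. e i x * e k x) has_integral (if i = k then 1 else 0)) {0..1}"
proof -
  have "L2_inner {0..1} (e i) (e k) = (if i = k then 1 else 0)"
    using basis assms unfolding L2_orthonormal_basis_def L2_orthonormal_def by blast
  then have "integral {0..1} (\<lambda>x. e i x * e k x) = (if i = k then 1 else 0)"
    unfolding L2_inner_continuous[OF continuous_e[OF assms(1)] continuous_e[OF assms(2)]] .
  moreover have "(\<lambda>x. e i x * e k x) integrable_on {0..1}"
    by (intro integrable_continuous_interval continuous_on_mult continuous_e assms)
  ultimately show ?thesis using integrable_integral by force
qed

lemma has_integral_e_f:
  assumes "i \<in> I" "continuous_on {0..1} f"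
  shows "((\<lambda>x. e i x * f x) has_integral coef f i) {0..1}"
  unfolding coef_def L2_inner_continuous[OF continuous_e[OF assms(1)] assms(2)]
  by (intro integrable_integral integrable_continuous_interval continuous_intros assms)

lemma integral_residual_square:
  assumes f: "continuous_on {0..1} f" and F: "finite F" "F \<subseteq> I"
  shows "integral {0..1} (\<lambda>x. (f x - (\<Sum>i\<in>F. c i * e i x))\<^sup>2)
           = integral {0..1} (\<lambda>x. (f x)\<^sup>2) - 2 * (\<Sum>i\<in>F. c i * coef f i) + (\<Sum>i\<in>F. (c i)\<^sup>2)"
proof (rule integral_unique)
  have eq: "(\<lambda>x. (f x - (\<Sum>i\<in>F. c i * e i x))\<^sup>2) = (\<lambda>x. (f x)\<^sup>2 - 2 * (\<Sum>i\<in>F. c i * (e i x * f x))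
            + (\<Sum>i\<in>F. \<Sum>k\<in>F. (c i * c k) * (e i x * e k x)))"
  proof
    fix x
    let ?S = "\<Sum>i\<in>F. c i * e i x"
    have "(f x - ?S)\<^sup>2 = (f x)\<^sup>2 - 2 * (?S * f x) + ?S * ?S"
      by (simp add: power2_eq_square algebra_simps)
    also have "?S * f x = (\<Sum>i\<in>F. c i * (e i x * f x))"
      by (simp add: sum_distrib_right mult.assoc)
    also have "?S * ?S = (\<Sum>i\<in>F. \<Sum>k\<in>F. (c i * c k) * (e i x * e k x))"
      by (simp add: sum_product mult_ac)
    finally show "(f x - ?S)\<^sup>2 = (f x)\<^sup>2 - 2 * (\<Sum>i\<in>F. c i * (e i x * f x))
            + (\<Sum>i\<in>F. \<Sum>k\<in>F. (c i * c k) * (e i x * e k x))" .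
  qed
  have "(\<Sum>i\<in>F. \<Sum>k\<in>F. (c i * c k) * (if i = k then 1 else 0)) = (\<Sum>i\<in>F. (c i)\<^sup>2)"
    using F by (simp add: power2_eq_square if_distrib cong: if_cong)
  moreover have "((\<lambda>x. (f x)\<^sup>2 - 2 * (\<Sum>i\<in>F. c i * (e i x * f x))
            + (\<Sum>i\<in>F. \<Sum>k\<in>F. (c i * c k) * (e i x * e k x))) has_integral
     (integral {0..1} (\<lambda>x. (f x)\<^sup>2) - 2 * (\<Sum>i\<in>F. c i * coef f i)
       + (\<Sum>i\<in>F. \<Sum>k\<in>F. (c i * c k) * (if i = k then 1 else 0)))) {0..1}"
    using F f by (intro has_integral_add has_integral_diff has_integral_mult_right has_integral_sum
        has_integral_e_e has_integral_e_f integrable_integral integrable_continuous_interval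
        continuous_intros) auto
  ultimately show "((\<lambda>x. (f x - (\<Sum>i\<in>F. c i * e i x))\<^sup>2) has_integral
     integral {0..1} (\<lambda>x. (f x)\<^sup>2) - 2 * (\<Sum>i\<in>F. c i * coef f i) + (\<Sum>i\<in>F. (c i)\<^sup>2)) {0..1}"
    unfolding eq by simp
qed

text \<open>
  The orthogonal projection onto the span of \<open>G\<close> is at least as good as any combination of elements of \<open>G\<close>:
  after completing squares in \<open>integral_residual_square\<close> the two sides differ by a sum of squares.
\<close>

lemma best_approximation:
  assumes f: "continuous_on {0..1} f" and G: "finite G" "G \<subseteq> I" "F \<subseteq> G"
  shows "integral {0..1} (\<lambda>x. (f x - (\<Sum>i\<in>G. coef f i * e i x))\<^sup>2)
           \<le> integral {0..1} (\<lambda>x. (f x - (\<Sum>i\<in>F. c i * e i x))\<^sup>2)"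
proof -
  have F: "finite F" "F \<subseteq> I" using G by (auto intro: finite_subset[of F G])
  have "2 * (\<Sum>i\<in>F. c i * coef f i) - (\<Sum>i\<in>F. (c i)\<^sup>2) = (\<Sum>i\<in>F. 2 * (c i * coef f i) - (c i)\<^sup>2)"
    by (simp add: sum_subtractf sum_distrib_left)
  also have "\<dots> \<le> (\<Sum>i\<in>F. (coef f i)\<^sup>2)"
  proof (intro sum_mono)
    fix i show "2 * (c i * coef f i) - (c i)\<^sup>2 \<le> (coef f i)\<^sup>2"
      using zero_le_power2[of "c i - coef f i"] by (simp add: power2_diff)
  qed
  also have "\<dots> \<le> (\<Sum>i\<in>G. (coef f i)\<^sup>2)"
    using G by (intro sum_mono2) auto
  finally show ?thesis
    unfolding integral_residual_square[OF f G(1,2)] integral_residual_square[OF f F]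
    by (simp add: power2_eq_square)
qed

lemma partial_sums_L2:
  assumes f: "continuous_on {0..1} f" and "0 < \<epsilon>"
  obtains K0 where "\<And>K. K0 \<le> K \<Longrightarrow> integral {0..1} (\<lambda>x. (f x - (\<Sum>j<K. detail f j x))\<^sup>2) < \<epsilon>"
proof -
  have "\<exists>F c. finite F \<and> F \<subseteq> I \<and> (LBINT x:{0..1}. (f x - (\<Sum>i\<in>F. c i * e i x))\<^sup>2) < \<epsilon>"
    using conjunct2[OF basis[unfolded L2_orthonormal_basis_def], rule_format, OF L2_fun_continuous[OF f] \<open>0 < \<epsilon>\<close>] .
  then obtain F c where F: "finite F" "F \<subseteq> I"
    and lt: "(LBINT x:{0..1}. (f x - (\<Sum>i\<in>F. c i * e i x))\<^sup>2) < \<epsilon>"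
    by blast
  have "(LBINT x:{0..1}. (f x - (\<Sum>i\<in>F. c i * e i x))\<^sup>2) = integral {0..1} (\<lambda>x. (f x - (\<Sum>i\<in>F. c i * e i x))\<^sup>2)"
    using F f by (intro set_borel_integral_eq_integral borel_integrable_atLeastAtMost' continuous_intros) auto
  with lt have lt: "integral {0..1} (\<lambda>x. (f x - (\<Sum>i\<in>F. c i * e i x))\<^sup>2) < \<epsilon>" by simp
  obtain K0 where K0: "\<And>i. i \<in> F \<Longrightarrow> lev i < K0"
    using finite_nat_set_iff_bounded[of "lev ` F"] F by auto
  show ?thesis
  proof (rule that)
    fix K assume "K0 \<le> K"
    then have "F \<subseteq> {i \<in> I. lev i < K}" using K0 F by fastforce
    from best_approximation[OF f finite_below _ this, of c] lt
    show "integral {0..1} (\<lambda>x. (f x - (\<Sum>j<K. detail f j x))\<^sup>2) < \<epsilon>"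
      unfolding detail_def sum_below_levels by auto
  qed
qed

lemma detail_continuous: "continuous_on {0..1} (detail f j)"
  unfolding detail_def by (intro continuous_on_sum continuous_on_mult continuous_on_const continuous_e) simp

context
  fixes f :: "real \<Rightarrow> real" and b t :: real
  assumes f: "continuous_on {0..1} f" and t: "0 < t" and b: "0 \<le> b"
    and decay: "\<And>i. i \<in> I \<Longrightarrow> \<bar>coef f i\<bar> \<le> b * 2 powr (- real (lev i) * (t + 1/2))"
begin

lemma detail_bound:
  assumes "x \<in> {0..1}"
  shows "\<bar>detail f j x\<bar> \<le> C\<^sup>2 * b * (2 powr (- t)) ^ j"
proof -
  have "\<bar>detail f j x\<bar> \<le> (\<Sum>i | i \<in> I \<and> lev i = j. \<bar>coef f i\<bar> * \<bar>e i x\<bar>)"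
    unfolding detail_def by (rule order.trans[OF sum_abs]) (simp add: abs_mult)
  also have "\<dots> \<le> C\<^sup>2 * (b * 2 powr (- real j * (t + 1/2))) * 2 powr (real j / 2)"
    using decay b by (intro level_sum_bound assms) auto
  also have "\<dots> = C\<^sup>2 * b * (2 powr (- real j * (t + 1/2)) * 2 powr (real j / 2))" by simp
  also have "2 powr (- real j * (t + 1/2)) * 2 powr (real j / 2) = (2 powr (- t)) ^ j"
    unfolding powr_power_two powr_add[symmetric] by (simp add: algebra_simps)
  finally show ?thesis .
qed

lemma detail_increment:
  assumes "x \<in> {0..1}" "y \<in> {0..1}" "0 < s" "s \<le> 1"
  shows "\<bar>detail f j x - detail f j y\<bar> \<le> 4 * C\<^sup>2 * b * \<bar>x - y\<bar> powr s * (2 powr (s - t)) ^ j"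
proof -
  have "\<bar>detail f j x - detail f j y\<bar> \<le> (\<Sum>i | i \<in> I \<and> lev i = j. \<bar>coef f i\<bar> * \<bar>e i x - e i y\<bar>)"
    unfolding detail_def sum_subtractf[symmetric]
    by (rule order.trans[OF sum_abs]) (simp add: abs_mult flip: right_diff_distrib)
  also have "\<dots> \<le> 4 * C\<^sup>2 * (b * 2 powr (- real j * (t + 1/2))) * 2 powr (real j / 2) * (2 ^ j * \<bar>x - y\<bar>) powr s"
    using decay b by (intro level_sum_increment assms) auto
  also have "(2 ^ j * \<bar>x - y\<bar>) powr s = 2 powr (real j * s) * \<bar>x - y\<bar> powr s"
    by (simp add: powr_mult powr_power_two[of 1, simplified] powr_powr)
  also have "4 * C\<^sup>2 * (b * 2 powr (- real j * (t + 1/2))) * 2 powr (real j / 2) * (2 powr (real j * s) * \<bar>x - y\<bar> powr s)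
     = 4 * C\<^sup>2 * b * \<bar>x - y\<bar> powr s * (2 powr (- real j * (t + 1/2)) * 2 powr (real j / 2) * 2 powr (real j * s))"
    by simp
  also have "2 powr (- real j * (t + 1/2)) * 2 powr (real j / 2) * 2 powr (real j * s) = (2 powr (s - t)) ^ j"
    unfolding powr_power_two powr_add[symmetric] by (simp add: algebra_simps)
  finally show ?thesis .
qed

lemma summable_detail:
  assumes "x \<in> {0..1}"
  shows "summable (\<lambda>j. detail f j x)"
proof (rule summable_comparison_test')
  show "summable (\<lambda>j. C\<^sup>2 * b * (2 powr (- t)) ^ j)"
    using two_powr_neg[OF t] by (intro summable_mult summable_geometric) simp
  show "norm (detail f j x) \<le> C\<^sup>2 * b * (2 powr (- t)) ^ j" for j
    unfolding real_norm_def by (rule detail_bound[OF assms])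
qed

lemma suminf_detail_tail:
  assumes x: "x \<in> {0..1}"
  shows "\<bar>(\<Sum>j. detail f j x) - (\<Sum>j<K. detail f j x)\<bar> \<le> C\<^sup>2 * b / (1 - 2 powr (- t)) * (2 powr (- t)) ^ K"
proof -
  have sm: "summable (\<lambda>j. C\<^sup>2 * b * (2 powr (- t)) ^ K * (2 powr (- t)) ^ j)"
    using two_powr_neg[OF t] by (intro summable_mult) auto
  have "norm (\<Sum>j. detail f (j + K) x) \<le> (\<Sum>j. C\<^sup>2 * b * (2 powr (- t)) ^ K * (2 powr (- t)) ^ j)"
  proof (rule norm_suminf_le[OF _ sm])
    fix j show "norm (detail f (j + K) x) \<le> C\<^sup>2 * b * (2 powr (- t)) ^ K * (2 powr (- t)) ^ j"
      using detail_bound[OF x, of "j + K"] by (simp add: power_add mult_ac)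
  qed
  also have "\<dots> = C\<^sup>2 * b * (2 powr (- t)) ^ K * (1 / (1 - 2 powr (- t)))"
    using two_powr_neg[OF t] by (subst suminf_mult) (auto simp: suminf_geometric)
  finally show ?thesis
    by (simp add: suminf_minus_initial_segment[OF summable_detail[OF x]])
qed

text \<open>
  The decay of the coefficients makes the wavelet series converge uniformly, to a continuous function \<open>g\<close>. By completeness
  of the basis its partial sums also converge to \<open>f\<close> in \<open>L\<^sup>2\<close>, so \<open>f - g\<close> has
  \<open>L\<^sup>2\<close> norm \<open>0\<close>; being continuous, it vanishes at every point.
\<close>

lemma detail_sums:
  assumes "x \<in> {0..1}"
  shows "(\<lambda>j. detail f j x) sums f x"
proof -
  define g where "g = (\<lambda>x. \<Sum>j. detail f j x)"
  let ?M = "C\<^sup>2 * b / (1 - 2 powr (- t))"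
  have g: "continuous_on {0..1} g"
    unfolding g_def
  proof (rule uniform_limit_theorem)
    show "uniform_limit {0..1} (\<lambda>n x. \<Sum>j<n. detail f j x) (\<lambda>x. \<Sum>j. detail f j x) sequentially"
      using detail_bound two_powr_neg[OF t] by (intro Weierstrass_m_test[where M = "\<lambda>j. C\<^sup>2 * b * (2 powr (- t)) ^ j"] summable_mult) auto
  qed (auto intro!: always_eventually continuous_intros detail_continuous)
  have le: "integral {0..1} (\<lambda>x. (f x - g x)\<^sup>2) \<le> \<epsilon>" if "0 < \<epsilon>" for \<epsilon>
  proof -
    obtain K0 where K0: "\<And>K. K0 \<le> K \<Longrightarrow> integral {0..1} (\<lambda>x. (f x - (\<Sum>j<K. detail f j x))\<^sup>2) < \<epsilon> / 4"
      using partial_sums_L2[OF f, of "\<epsilon> / 4"] \<open>0 < \<epsilon>\<close> by auto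
    have "(\<lambda>K. (2 powr (- t)) ^ K) \<longlonglongrightarrow> 0"
      using two_powr_neg[OF t] by (intro LIMSEQ_power_zero) auto
    from tendsto_mult[OF tendsto_const[of 2] tendsto_power[OF tendsto_mult[OF tendsto_const[of ?M] this], of 2]]
    have "eventually (\<lambda>K. 2 * (?M * (2 powr (- t)) ^ K)\<^sup>2 < \<epsilon> / 2) sequentially"
      by (rule order_tendstoD(2)) (use \<open>0 < \<epsilon>\<close> in auto)
    then have "eventually (\<lambda>K. 2 * (?M * (2 powr (- t)) ^ K)\<^sup>2 < \<epsilon> / 2 \<and> K0 \<le> K) sequentially"
      using eventually_ge_at_top[of K0] by eventually_elim auto
    then obtain K where K: "2 * (?M * (2 powr (- t)) ^ K)\<^sup>2 < \<epsilon> / 2" "K0 \<le> K"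
      by (auto simp: eventually_sequentially)
    let ?P = "\<lambda>x. \<Sum>j<K. detail f j x"
    have "integral {0..1} (\<lambda>x. (f x - g x)\<^sup>2)
        \<le> integral {0..1} (\<lambda>x. 2 * (f x - ?P x)\<^sup>2 + 2 * (?M * (2 powr (- t)) ^ K)\<^sup>2)"
    proof (intro integral_le integrable_continuous_interval continuous_on_add continuous_on_mult continuous_on_power
        continuous_on_diff continuous_on_sum continuous_on_const f g detail_continuous)
      fix x :: real assume x: "x \<in> {0..1}"
      have "(f x - g x)\<^sup>2 \<le> 2 * (f x - ?P x)\<^sup>2 + 2 * (g x - ?P x)\<^sup>2"
        using zero_le_power2[of "(f x - ?P x) + (g x - ?P x)"] by (simp add: power2_eq_square algebra_simps)
      moreover have "(g x - ?P x)\<^sup>2 \<le> (?M * (2 powr (- t)) ^ K)\<^sup>2"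
        unfolding abs_le_square_iff[symmetric] g_def
        by (rule order.trans[OF suminf_detail_tail[OF x, of K] abs_ge_self])
      ultimately show "(f x - g x)\<^sup>2 \<le> 2 * (f x - ?P x)\<^sup>2 + 2 * (?M * (2 powr (- t)) ^ K)\<^sup>2"
        by linarith
    qed
    also have "\<dots> = 2 * integral {0..1} (\<lambda>x. (f x - ?P x)\<^sup>2) + 2 * (?M * (2 powr (- t)) ^ K)\<^sup>2"
    proof (rule integral_unique)
      have "(\<lambda>x. (f x - ?P x)\<^sup>2) integrable_on {0..1}"
        by (intro integrable_continuous_interval continuous_on_power continuous_on_diff continuous_on_sum
            f detail_continuous)
      from has_integral_add[OF has_integral_mult_right[OF integrable_integral[OF this]]
          has_integral_const_real[of "2 * (?M * (2 powr (- t)) ^ K)\<^sup>2" 0 1], of 2]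
      show "((\<lambda>x. 2 * (f x - ?P x)\<^sup>2 + 2 * (?M * (2 powr (- t)) ^ K)\<^sup>2) has_integral
        2 * integral {0..1} (\<lambda>x. (f x - ?P x)\<^sup>2) + 2 * (?M * (2 powr (- t)) ^ K)\<^sup>2) {0..1}"
        by (simp only: content_real zero_le_one diff_zero scaleR_one)
    qed
    also have "\<dots> \<le> \<epsilon>" using K0[OF K(2)] K(1) by linarith
    finally show ?thesis .
  qed
  have "integral {0..1} (\<lambda>x. (f x - g x)\<^sup>2) \<le> 0"
    by (rule field_le_epsilon) (simp only: add_0_left le)
  moreover have "0 \<le> integral {0..1} (\<lambda>x. (f x - g x)\<^sup>2)"
    by (intro integral_nonneg integrable_continuous_interval continuous_on_power continuous_on_diff f g) simp
  ultimately have "integral {0..1} (\<lambda>x. (f x - g x)\<^sup>2) = 0" by (rule antisym)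
  then have "\<forall>x\<in>{0..1}. (f x - g x)\<^sup>2 = 0"
    by (subst (asm) integral_eq_0_iff) (simp_all add: continuous_on_power continuous_on_diff f g)
  then have "f x = g x" using assms by auto
  then show ?thesis
    using summable_detail[OF assms] unfolding g_def by (simp add: summable_sums)
qed

lemma detail_tail:
  assumes x: "x \<in> {0..1}"
  shows "\<bar>f x - (\<Sum>j<K. detail f j x)\<bar> \<le> C\<^sup>2 * b / (1 - 2 powr (- t)) * (2 powr (- t)) ^ K"
  using suminf_detail_tail[OF x, of K] unfolding sums_unique[OF detail_sums[OF x], symmetric] .

text \<open>
  For \<open>s < t\<close> the increments of the individual levels, each of order \<open>s\<close>, are summable.
\<close>

lemma hoelder:
  assumes "x \<in> {0..1}" "y \<in> {0..1}" "0 < s" "s \<le> 1" "s < t"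
  shows "\<bar>f x - f y\<bar> \<le> 4 * C\<^sup>2 * b / (1 - 2 powr (s - t)) * \<bar>x - y\<bar> powr s"
proof -
  let ?q = "2 powr (s - t) :: real"
  have q: "0 \<le> ?q" "?q < 1"
    using powr_less_mono[of "s - t" 0 2] assms(5) by simp_all
  have sm: "summable (\<lambda>j. 4 * C\<^sup>2 * b * \<bar>x - y\<bar> powr s * ?q ^ j)"
    using q by (intro summable_mult summable_geometric) simp
  have eq: "f x - f y = (\<Sum>j. detail f j x - detail f j y)"
    by (rule sums_unique[OF sums_diff[OF detail_sums[OF assms(1)] detail_sums[OF assms(2)]]])
  have "norm (f x - f y) \<le> (\<Sum>j. 4 * C\<^sup>2 * b * \<bar>x - y\<bar> powr s * ?q ^ j)"
    unfolding eq
  proof (rule norm_suminf_le[OF _ sm])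
    fix j show "norm (detail f j x - detail f j y) \<le> 4 * C\<^sup>2 * b * \<bar>x - y\<bar> powr s * ?q ^ j"
      unfolding real_norm_def by (rule detail_increment[OF assms(1-4)])
  qed
  moreover have "(\<lambda>j. 4 * C\<^sup>2 * b * \<bar>x - y\<bar> powr s * ?q ^ j) sums
      (4 * C\<^sup>2 * b * \<bar>x - y\<bar> powr s * (1 / (1 - ?q)))"
    using q by (intro sums_mult geometric_sums) simp
  ultimately have "norm (f x - f y) \<le> 4 * C\<^sup>2 * b * \<bar>x - y\<bar> powr s * (1 / (1 - ?q))"
    using sums_unique by metis
  then show ?thesis by simp
qed

end

end


section \<open>The thresholding estimator\<close>

definition threshold :: "real \<Rightarrow> nat \<Rightarrow> real" where
  "threshold \<sigma> n = 3 * \<sigma> * sqrt (ln (real n) / real n)"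

lemma threshold_nonneg: "0 < \<sigma> \<Longrightarrow> 0 \<le> threshold \<sigma> n"
  unfolding threshold_def by (cases "n = 0") auto

context local_lipschitz_basis
begin

definition active :: "nat \<Rightarrow> 'i set" where
  "active n = {i \<in> I. 2 ^ lev i \<le> real n}"

definition threshold_estimator :: "real \<Rightarrow> nat \<Rightarrow> (nat \<Rightarrow> real) \<Rightarrow> real \<Rightarrow> real" where
  "threshold_estimator \<sigma> n y x = (\<Sum>i\<in>active n. soft_threshold (threshold \<sigma> n) (step_coef n (e i) y) * e i x)"

lemma active_eq:
  assumes "\<And>j. j < K \<longleftrightarrow> 2 ^ j \<le> real n"
  shows "active n = {i \<in> I. lev i < K}"
  unfolding active_def assms ..

lemma finite_active: "finite (active n)"
proof (rule finite_subset[OF _ finite_below])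
  show "active n \<subseteq> {i \<in> I. lev i < Suc n}"
  proof
    fix i assume i: "i \<in> active n"
    have "real (lev i) < 2 ^ lev i" by (rule of_nat_less_two_power)
    also have "\<dots> \<le> real n" using i by (simp add: active_def)
    finally show "i \<in> {i \<in> I. lev i < Suc n}" using i by (simp add: active_def)
  qed
qed

lemma card_active: "1 \<le> n \<Longrightarrow> real (card (active n)) \<le> 2 * C * real n"
proof -
  assume "1 \<le> n"
  then obtain K where K: "\<And>j. j < K \<longleftrightarrow> 2 ^ j \<le> real n" "2 ^ K \<le> 2 * real n"
    using power_of_two_crossing[of "real n"] by auto
  have "real (card (active n)) = (\<Sum>i | i \<in> I \<and> lev i < K. 1)"
    unfolding active_eq[OF K(1)] by simp
  also have "\<dots> = (\<Sum>j<K. real (card {i \<in> I. lev i = j}))"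
    unfolding sum_below_levels by simp
  also have "\<dots> \<le> (\<Sum>j<K. C * 2 ^ j)" by (intro sum_mono card_level)
  also have "\<dots> = C * (2 ^ K - 1)"
    by (simp add: mask_eq_sum_exp geometric_sum flip: sum_distrib_left)
  also have "\<dots> \<le> C * (2 * real n)" using K(2) C_ge_1 by (intro mult_left_mono) auto
  finally show ?thesis by simp
qed

lemma estimator_threshold_estimator: "estimator n (threshold_estimator \<sigma> n)"
proof (rule estimatorI)
  show "(\<lambda>y. threshold_estimator \<sigma> n y x) \<in> borel_measurable (\<Pi>\<^sub>M i\<in>{1..n}. borel)" for x
    unfolding threshold_estimator_def by measurable
  show "continuous_on {0..1} (threshold_estimator \<sigma> n y)" for y
    unfolding threshold_estimator_def
    by (intro continuous_on_sum continuous_on_mult continuous_on_const continuous_e) (simp add: active_def)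
qed

text \<open>
  The noise in an empirical coefficient has variance at most \<open>\<sigma>\<^sup>2/n\<close> because \<open>e i\<close> is normalised in \<open>L\<^sup>2\<close>. The choice
  \<open>\<kappa> = \<tau> n / \<sigma>\<^sup>2\<close> makes the exponent in \<open>gaussian_excess\<close> minimal, namely \<open>-(9/2) log n\<close>; this explains
  the factor \<open>3\<close> in the threshold.
\<close>

lemma coefficient_noise_excess:
  assumes "0 < \<sigma>" "3 \<le> n" "i \<in> I"
  shows "(\<integral>\<^sup>+\<epsilon>. ennreal (max 0 (\<bar>step_coef n (e i) \<epsilon>\<bar> - threshold \<sigma> n)) \<partial>noise \<sigma> n)
           \<le> ennreal (2 * \<sigma> * real n powr (- 4))"
proof -
  define L where "L = ln (real n)"
  have L: "1 \<le> L" unfolding L_def by (rule one_le_ln[OF assms(2)])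
  have n: "0 < real n" using assms by simp
  define \<kappa> where "\<kappa> = 3 * sqrt (real n * L) / \<sigma>"
  have "1 * 1 \<le> real n * L" using assms(2) L by (intro mult_mono) auto
  then have sq: "1 \<le> sqrt (real n * L)" by simp
  have \<kappa>: "0 < \<kappa>" unfolding \<kappa>_def using sq assms(1) by (intro divide_pos_pos mult_pos_pos) auto
  have "integral {0..1} (\<lambda>x. (e i x)\<^sup>2) = 1"
    using integral_unique[OF has_integral_e_e[OF assms(3,3)]] by (simp add: power2_eq_square)
  then have v: "(\<Sum>k\<in>{1..n}. (integral {(real k - 1) / real n..real k / real n} (e i))\<^sup>2) \<le> 1 / real n"
    using step_weights_sum_squares[OF continuous_e[OF assms(3)], of n] assms(2) by simp
  have "\<sigma>\<^sup>2 * \<kappa>\<^sup>2 * (1 / real n) / 2 - \<kappa> * threshold \<sigma> n = - (9 / 2) * L"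
  proof -
    have "\<sigma>\<^sup>2 * \<kappa>\<^sup>2 * (1 / real n) / 2 = 9 / 2 * L"
      using assms(1) L n by (simp add: \<kappa>_def power_divide power_mult_distrib)
    moreover have "\<kappa> * threshold \<sigma> n = 9 * (sqrt (real n * L) * sqrt (L / real n))"
      using assms(1) by (simp add: \<kappa>_def threshold_def L_def)
    moreover have "sqrt (real n * L) * sqrt (L / real n) = L"
      using L n by (simp flip: real_sqrt_mult)
    ultimately show ?thesis by simp
  qed
  moreover have "2 / \<kappa> * exp (- (9 / 2) * L) \<le> 2 * \<sigma> * real n powr (- 4)"
  proof (rule mult_mono)
    have "2 / \<kappa> = 2 * \<sigma> / (3 * sqrt (real n * L))" by (simp add: \<kappa>_def)
    also have "\<dots> \<le> 2 * \<sigma> / 1" using sq assms(1) by (intro divide_left_mono) linarith+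
    finally show "2 / \<kappa> \<le> 2 * \<sigma>" by simp
    show "exp (- (9 / 2) * L) \<le> real n powr (- 4)"
      using n L by (simp add: powr_def L_def)
  qed (use assms in auto)
  ultimately show ?thesis
    using order.trans[OF gaussian_excess[OF assms(1) \<kappa> v, of "threshold \<sigma> n"] ennreal_leI]
    unfolding step_coef_def by simp
qed

text \<open>
  The deterministic part of the argument: for every realisation of the noise, the error at \<open>x\<close> is of the order of the
  rate, up to the part of the noise that exceeds the threshold. The constant \<open>D\<close> is the same for
  all functions with the given coefficient decay.
\<close>

lemma pointwise_error:
  assumes \<sigma>: "0 < \<sigma>" and t: "0 < t" and b: "0 \<le> b"
  obtains D where "0 \<le> D" "\<And>f n \<epsilon> x. continuous_on {0..1} f \<Longrightarrow>
    (\<And>i. i \<in> I \<Longrightarrow> \<bar>coef f i\<bar> \<le> b * 2 powr (- real (lev i) * (t + 1/2))) \<Longrightarrow> 3 \<le> n \<Longrightarrow> x \<in> {0..1} \<Longrightarrow>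
    \<bar>threshold_estimator \<sigma> n (observations n f \<epsilon>) x - f x\<bar> \<le> D * rate n t
      + (\<Sum>i\<in>active n. C * 2 powr (real (lev i) / 2) * max 0 (\<bar>step_coef n (e i) \<epsilon>\<bar> - threshold \<sigma> n))"
proof -
  \<comment> \<open>The Hoelder exponent has to be below \<open>t\<close> for \<open>hoelder\<close>, and above the exponent \<open>\<theta>\<close> of the rate so
    that the design bias \<open>n\<^bsup>-s\<^esup>\<close> can be summed over logarithmically many levels.\<close>
  define \<theta> where "\<theta> = t / (2 * t + 1)"
  have "\<theta> < t" "\<theta> < 1"
    unfolding \<theta>_def using t by (auto simp: divide_less_eq)
  then obtain s where s: "\<theta> < s" "s < t" "s \<le> 1"
    using dense[of \<theta> "min t 1"] by auto
  have \<theta>: "0 < \<theta>" unfolding \<theta>_def using t by simp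
  define H where "H = 4 * C\<^sup>2 * b / (1 - 2 powr (s - t))"
  define a :: real where "a = 2 powr (- t)"
  define q :: real where "q = 2 powr (\<theta> - s)"
  have a: "0 \<le> a" "a < 1" unfolding a_def using two_powr_neg[OF t] by simp_all
  have q: "0 \<le> q" "q < 1" unfolding q_def using powr_less_mono[of "\<theta> - s" 0 2] s by simp_all
  have H: "0 \<le> H"
    unfolding H_def using powr_less_mono[of "s - t" 0 2] s b by simp
  \<comment> \<open>constants for the design bias, the thresholding error and the truncation error\<close>
  define D1 where "D1 = C ^ 3 * H / (1 - q)"
  define D2 where "D2 = C\<^sup>2 * (b / (1 - a) + 6 * \<sigma> * sqrt 2 / (sqrt 2 - 1))"
  define D3 where "D3 = C\<^sup>2 * b / (1 - a)"
  show ?thesis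
  proof (rule that[of "D1 + D2 + D3"])
    show "0 \<le> D1 + D2 + D3"
      unfolding D1_def D2_def D3_def using a q b H C_ge_1 \<sigma> by (intro add_nonneg_nonneg mult_nonneg_nonneg divide_nonneg_nonneg) auto
  next
    fix f :: "real \<Rightarrow> real" and n :: nat and \<epsilon> :: "nat \<Rightarrow> real" and x :: real
    assume f: "continuous_on {0..1} f" and n: "3 \<le> n" and x: "x \<in> {0..1}"
      and decay: "\<And>i. i \<in> I \<Longrightarrow> \<bar>coef f i\<bar> \<le> b * 2 powr (- real (lev i) * (t + 1/2))"
    let ?\<tau> = "threshold \<sigma> n"
    have n0: "1 \<le> real n" using n by simp
    obtain K where K: "\<And>j. j < K \<longleftrightarrow> 2 ^ j \<le> real n" "2 ^ K \<le> 2 * real n"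
      using power_of_two_crossing[OF n0] by blast
    have act: "active n = {i. i \<in> I \<and> lev i < K}" by (rule active_eq[OF K(1)])
    define bh where "bh = (\<lambda>i. soft_threshold ?\<tau> (step_coef n (e i) (observations n f \<epsilon>)))"
    define exc where "exc = (\<lambda>i. max 0 (\<bar>step_coef n (e i) \<epsilon>\<bar> - ?\<tau>))"
    define h where "h = H * real n powr (- s)"
    have h0: "0 \<le> h" unfolding h_def using H by simp
    \<comment> \<open>\<open>M j\<close> bounds the error of a coefficient on level \<open>j\<close> when its noise is below the threshold\<close>
    define M where "M = (\<lambda>j. h * (C * 2 powr (- real j / 2)) + min (b * 2 powr (- real j * (t + 1/2))) (2 * ?\<tau>))"
    have M0: "0 \<le> M j" for j
      unfolding M_def using h0 C_ge_1 b threshold_nonneg[OF \<sigma>, of n] by auto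
    have osc: "\<bar>f x - f y\<bar> \<le> h" if "x \<in> {0..1}" "y \<in> {0..1}" "\<bar>x - y\<bar> \<le> 1 / real n" for x y
    proof -
      have "\<bar>f x - f y\<bar> \<le> H * \<bar>x - y\<bar> powr s"
        unfolding H_def using hoelder[OF f t b decay that(1,2)] s \<theta> by simp
      also have "\<dots> \<le> H * (1 / real n) powr s"
        using H s \<theta> that(3) by (intro mult_left_mono powr_mono2) auto
      also have "(1 / real n) powr s = real n powr (- s)"
        by (simp add: powr_minus_divide powr_divide)
      finally show ?thesis by (simp add: h_def)
    qed
    have coef_error: "\<bar>bh i - coef f i\<bar> \<le> M (lev i) + exc i" if i: "i \<in> I" for i
    proof -
      define d where "d = step_coef n (e i) (\<lambda>k. f (real k / real n)) - coef f i"
      have "\<bar>d\<bar> \<le> h * integral {0..1} (\<lambda>x. \<bar>e i x\<bar>)"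
        unfolding d_def coef_def L2_inner_continuous[OF continuous_e[OF i] f]
        using n by (intro step_coef_bias f continuous_e i osc) auto
      also have "\<dots> \<le> h * (C * 2 powr (- real (lev i) / 2))"
        by (intro mult_left_mono integral_abs i h0)
      finally have d: "\<bar>d\<bar> \<le> h * (C * 2 powr (- real (lev i) / 2))" .
      have "bh i = soft_threshold ?\<tau> (coef f i + d + step_coef n (e i) \<epsilon>)"
        unfolding bh_def step_coef_observations d_def by simp
      then have "\<bar>bh i - coef f i\<bar> \<le> \<bar>d\<bar> + min \<bar>coef f i\<bar> (2 * ?\<tau>) + exc i"
        unfolding exc_def using soft_threshold_error[OF threshold_nonneg[OF \<sigma>]] by simp
      also have "\<dots> \<le> M (lev i) + exc i"
        unfolding M_def using d decay[OF i] by (intro add_mono min.mono) auto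
      finally show ?thesis .
    qed
    have "threshold_estimator \<sigma> n (observations n f \<epsilon>) x - f x
        = (\<Sum>i\<in>active n. (bh i - coef f i) * e i x) - (f x - (\<Sum>j<K. detail f j x))"
      unfolding threshold_estimator_def bh_def act detail_def sum_below_levels[symmetric]
      by (simp add: left_diff_distrib sum_subtractf)
    then have "\<bar>threshold_estimator \<sigma> n (observations n f \<epsilon>) x - f x\<bar>
        \<le> \<bar>\<Sum>i\<in>active n. (bh i - coef f i) * e i x\<bar> + \<bar>f x - (\<Sum>j<K. detail f j x)\<bar>"
      by linarith
    moreover have "\<bar>f x - (\<Sum>j<K. detail f j x)\<bar> \<le> D3 * rate n t"
    proof -
      have "\<bar>f x - (\<Sum>j<K. detail f j x)\<bar> \<le> D3 * a ^ K"
        unfolding D3_def a_def by (rule detail_tail[OF f t b decay x])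
      also have "a ^ K = (2 ^ K) powr (- t)"
        unfolding a_def by (simp add: powr_power_two powr_powr flip: powr_realpow)
      also have "D3 * (2 ^ K) powr (- t) \<le> D3 * real n powr (- t)"
        using K(1)[of K] n0 t a b by (intro mult_left_mono powr_mono2') (auto simp: D3_def)
      also have "\<dots> \<le> D3 * rate n t"
        using n t a b \<open>\<theta> < t\<close> by (intro mult_left_mono powr_minus_le_rate) (auto simp: D3_def \<theta>_def)
      finally show ?thesis .
    qed
    moreover have "\<bar>\<Sum>i\<in>active n. (bh i - coef f i) * e i x\<bar>
        \<le> (\<Sum>i\<in>active n. \<bar>M (lev i)\<bar> * \<bar>e i x\<bar>) + (\<Sum>i\<in>active n. C * 2 powr (real (lev i) / 2) * exc i)"
      unfolding sum.distrib[symmetric]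
    proof (intro order.trans[OF sum_abs] sum_mono)
      fix i assume "i \<in> active n"
      then have i: "i \<in> I" by (simp add: active_def)
      have "\<bar>(bh i - coef f i) * e i x\<bar> \<le> (M (lev i) + exc i) * \<bar>e i x\<bar>"
        unfolding abs_mult by (intro mult_right_mono coef_error i) simp
      also have "\<dots> = \<bar>M (lev i)\<bar> * \<bar>e i x\<bar> + \<bar>e i x\<bar> * exc i"
        using M0 by (simp add: algebra_simps)
      also have "\<dots> \<le> \<bar>M (lev i)\<bar> * \<bar>e i x\<bar> + C * 2 powr (real (lev i) / 2) * exc i"
        using bound[OF i x] by (intro add_left_mono mult_right_mono) (auto simp: exc_def)
      finally show "\<bar>(bh i - coef f i) * e i x\<bar> \<le> \<bar>M (lev i)\<bar> * \<bar>e i x\<bar> + C * 2 powr (real (lev i) / 2) * exc i" .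
    qed
    moreover have "(\<Sum>i\<in>active n. \<bar>M (lev i)\<bar> * \<bar>e i x\<bar>) \<le> (D1 + D2) * rate n t"
    proof -
      have "(\<Sum>i\<in>active n. \<bar>M (lev i)\<bar> * \<bar>e i x\<bar>) \<le> (\<Sum>j<K. C\<^sup>2 * M j * 2 powr (real j / 2))"
        unfolding act sum_below_levels using M0 by (intro sum_mono level_sum_bound x) auto
      also have "\<dots> = (\<Sum>j<K. C ^ 3 * H * real n powr (- s)) + (\<Sum>j<K. C\<^sup>2 *
            min (b * 2 powr (- real j * t)) (6 * \<sigma> * sqrt (ln (real n) / real n) * 2 powr (real j / 2)))"
        unfolding sum.distrib[symmetric]
      proof (rule sum.cong[OF refl])
        fix j
        have "C\<^sup>2 * M j * 2 powr (real j / 2)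
          = C\<^sup>2 * h * C * (2 powr (- real j / 2) * 2 powr (real j / 2))
            + C\<^sup>2 * (min (b * 2 powr (- real j * (t + 1/2))) (2 * ?\<tau>) * 2 powr (real j / 2))"
          unfolding M_def by (simp add: algebra_simps)
        also have "2 powr (- real j / 2) * 2 powr (real j / 2) = (1::real)"
          by (simp flip: powr_add)
        also have "min (b * 2 powr (- real j * (t + 1/2))) (2 * ?\<tau>) * 2 powr (real j / 2)
          = min (b * (2 powr (- real j * (t + 1/2)) * 2 powr (real j / 2))) (2 * ?\<tau> * 2 powr (real j / 2))"
          by (simp add: min_mult_distrib_right mult.assoc)
        also have "2 powr (- real j * (t + 1/2)) * 2 powr (real j / 2) = 2 powr (- real j * t)"
          unfolding powr_add[symmetric] by (simp add: algebra_simps)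
        finally show "C\<^sup>2 * M j * 2 powr (real j / 2) = C ^ 3 * H * real n powr (- s) + C\<^sup>2 *
            min (b * 2 powr (- real j * t)) (6 * \<sigma> * sqrt (ln (real n) / real n) * 2 powr (real j / 2))"
          by (simp add: h_def threshold_def power2_eq_square power3_eq_cube mult_ac)
      qed
      also have "(\<Sum>j<K. C ^ 3 * H * real n powr (- s)) \<le> D1 * rate n t"
      proof -
        have "(\<Sum>j<K. C ^ 3 * H * real n powr (- s)) \<le> (\<Sum>j<K. C ^ 3 * H * (real n powr (- \<theta>) * q ^ j))"
        \<comment> \<open>as \<open>2\<^sup>j \<le> n\<close>, the gain \<open>n\<^bsup>\<theta> - s\<^esup>\<close> over the rate is at most \<open>2\<^bsup>j(\<theta> - s)\<^esup>\<close>, which is summable in \<open>j\<close>\<close>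
        proof (intro sum_mono mult_left_mono)
          fix j assume "j \<in> {..<K}"
          then have j: "2 ^ j \<le> real n" using K(1) by simp
          have "real n powr (- s) = real n powr (- \<theta>) * real n powr (\<theta> - s)"
            by (simp flip: powr_add)
          also have "real n powr (\<theta> - s) \<le> (2 ^ j) powr (\<theta> - s)"
            using j s by (intro powr_mono2') auto
          also have "(2 ^ j) powr (\<theta> - s) = q ^ j"
            unfolding q_def by (simp add: powr_power_two powr_powr flip: powr_realpow)
          finally show "real n powr (- s) \<le> real n powr (- \<theta>) * q ^ j" by (simp add: mult_left_mono)
        qed (use H C_ge_1 in auto)
        also have "\<dots> = C ^ 3 * H * real n powr (- \<theta>) * (\<Sum>j<K. q ^ j)"
          by (simp add: sum_distrib_left mult.assoc)
        also have "\<dots> \<le> C ^ 3 * H * real n powr (- \<theta>) * (q ^ 0 / (1 - q))"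
          using geometric_tail_bound[OF q, of "{..<K}" 0] H C_ge_1 by (intro mult_left_mono) auto
        also have "\<dots> = D1 * real n powr (- \<theta>)" by (simp add: D1_def)
        also have "\<dots> \<le> D1 * rate n t"
          using n t q H C_ge_1 by (intro mult_left_mono powr_minus_le_rate) (auto simp: D1_def \<theta>_def)
        finally show ?thesis .
      qed
      also have "(\<Sum>j<K. C\<^sup>2 * min (b * 2 powr (- real j * t)) (6 * \<sigma> * sqrt (ln (real n) / real n) * 2 powr (real j / 2)))
          \<le> D2 * rate n t"
      proof -
        \<comment> \<open>\<open>u\<close> is the resolution \<open>2\<^sup>j\<close> at which \<open>2\<^bsup>-j(t+1/2)\<^esup>\<close> equals \<open>sqrt (log n / n)\<close>\<close>
        define u where "u = (real n / ln (real n)) powr (1 / (2 * t + 1))"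
        have L: "1 \<le> ln (real n)" by (rule one_le_ln[OF n])
        have x1: "1 \<le> real n / ln (real n)" using n L ln_le_minus_one[of "real n"] by (auto simp: le_divide_eq)
        have u: "1 \<le> u" unfolding u_def using x1 t by (intro ge_one_powr_ge_zero) auto
        have ut: "u powr (- t) = rate n t"
          unfolding u_def rate_eq_powr[OF n] powr_powr by simp
        have "u powr (- t - 1/2) = (real n / ln (real n)) powr (- (1 / 2))"
        proof -
          have "1 / (2 * t + 1) * (- t - 1/2) = - (1 / 2)" using t by (simp add: field_simps)
          then show ?thesis unfolding u_def powr_powr by simp
        qed
        also have "\<dots> = sqrt (ln (real n) / real n)"
          using x1 by (simp add: powr_minus powr_half_sqrt real_sqrt_divide)
        finally have us: "u powr (- t - 1/2) = sqrt (ln (real n) / real n)" .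
        have "(\<Sum>j<K. min (b * 2 powr (- real j * t)) (6 * \<sigma> * u powr (- t - 1/2) * 2 powr (real j / 2)))
          \<le> (b / (1 - 2 powr (- t)) + 6 * \<sigma> * sqrt 2 / (sqrt 2 - 1)) * u powr (- t)"
          using \<sigma> by (intro balanced_geometric_sum t u b) auto
        from mult_left_mono[OF this[unfolded us ut], of "C\<^sup>2"] show ?thesis
          unfolding D2_def a_def sum_distrib_left[symmetric] by (simp add: mult.assoc)
      qed
      finally show ?thesis by (simp add: algebra_simps)
    qed
    ultimately show "\<bar>threshold_estimator \<sigma> n (observations n f \<epsilon>) x - f x\<bar> \<le> (D1 + D2 + D3) * rate n t
      + (\<Sum>i\<in>active n. C * 2 powr (real (lev i) / 2) * max 0 (\<bar>step_coef n (e i) \<epsilon>\<bar> - threshold \<sigma> n))"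
      unfolding exc_def by (simp add: algebra_simps)
  qed
qed

text \<open>
  Taking expectations in \<open>pointwise_error\<close>: the bound there is uniform in \<open>x\<close>, and the sum of the expected excesses is at
  most \<open>2Cn \<cdot> Cn \<cdot> 2\<sigma>n\<^bsup>-4\<^esup> = 4C\<^sup>2\<sigma>n\<^bsup>-2\<^esup>\<close>, hence at most a multiple of the rate.
\<close>

lemma sup_risk_bound:
  assumes \<sigma>: "0 < \<sigma>" and t: "0 < t" and b: "0 \<le> b"
  obtains D where "\<And>f n. continuous_on {0..1} f \<Longrightarrow>
    (\<And>i. i \<in> I \<Longrightarrow> \<bar>coef f i\<bar> \<le> b * 2 powr (- real (lev i) * (t + 1/2))) \<Longrightarrow> 3 \<le> n \<Longrightarrow>
    sup_risk \<sigma> n (threshold_estimator \<sigma> n) f \<le> ennreal (D * rate n t)"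
proof -
  obtain D where D: "0 \<le> D" "\<And>f n \<epsilon> x. continuous_on {0..1} f \<Longrightarrow>
    (\<And>i. i \<in> I \<Longrightarrow> \<bar>coef f i\<bar> \<le> b * 2 powr (- real (lev i) * (t + 1/2))) \<Longrightarrow> 3 \<le> n \<Longrightarrow> x \<in> {0..1} \<Longrightarrow>
    \<bar>threshold_estimator \<sigma> n (observations n f \<epsilon>) x - f x\<bar> \<le> D * rate n t
      + (\<Sum>i\<in>active n. C * 2 powr (real (lev i) / 2) * max 0 (\<bar>step_coef n (e i) \<epsilon>\<bar> - threshold \<sigma> n))"
    using pointwise_error[OF assms] by blast
  show ?thesis
  proof (rule that[of "D + 4 * C\<^sup>2 * \<sigma>"])
    fix f n assume f: "continuous_on {0..1} f" and n: "3 \<le> (n::nat)"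
      and decay: "\<And>i. i \<in> I \<Longrightarrow> \<bar>coef f i\<bar> \<le> b * 2 powr (- real (lev i) * (t + 1/2))"
    define exc where "exc = (\<lambda>i \<epsilon>. max 0 (\<bar>step_coef n (e i) \<epsilon>\<bar> - threshold \<sigma> n))"
    have meas: "(\<lambda>\<epsilon>. ennreal (exc i \<epsilon>)) \<in> borel_measurable (noise \<sigma> n)" for i
      unfolding measurable_noise exc_def by measurable
    have r0: "0 \<le> rate n t" by (simp add: rate_def)
    have n0: "0 < real n" using n by simp
    have "sup_risk \<sigma> n (threshold_estimator \<sigma> n) f
        \<le> (\<integral>\<^sup>+\<epsilon>. ennreal (D * rate n t) + (\<Sum>i\<in>active n. ennreal (C * real n) * ennreal (exc i \<epsilon>)) \<partial>noise \<sigma> n)"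
      unfolding sup_risk_def
    proof (rule nn_integral_mono)
      fix \<epsilon>
      show "sup_dist (threshold_estimator \<sigma> n (observations n f \<epsilon>)) f
          \<le> ennreal (D * rate n t) + (\<Sum>i\<in>active n. ennreal (C * real n) * ennreal (exc i \<epsilon>))"
        unfolding sup_dist_def
      proof (rule SUP_least)
        fix x :: real assume x: "x \<in> {0..1}"
        have "\<bar>threshold_estimator \<sigma> n (observations n f \<epsilon>) x - f x\<bar>
            \<le> D * rate n t + (\<Sum>i\<in>active n. C * 2 powr (real (lev i) / 2) * exc i \<epsilon>)"
          unfolding exc_def by (rule D(2)[OF f decay n x])
        also have "\<dots> \<le> D * rate n t + (\<Sum>i\<in>active n. C * real n * exc i \<epsilon>)"
        proof (intro add_left_mono sum_mono mult_right_mono mult_left_mono)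
          fix i assume "i \<in> active n"
          then have "2 powr real (lev i) \<le> real n" by (simp add: active_def powr_realpow)
          moreover have "2 powr (real (lev i) / 2) \<le> 2 powr real (lev i)" by (intro powr_mono) auto
          ultimately show "2 powr (real (lev i) / 2) \<le> real n" by linarith
        qed (use C_ge_1 in \<open>auto simp: exc_def\<close>)
        finally have "ennreal \<bar>threshold_estimator \<sigma> n (observations n f \<epsilon>) x - f x\<bar>
            \<le> ennreal (D * rate n t + (\<Sum>i\<in>active n. C * real n * exc i \<epsilon>))"
          by (rule ennreal_leI)
        also have "\<dots> = ennreal (D * rate n t) + ennreal (\<Sum>i\<in>active n. C * real n * exc i \<epsilon>)"
          using D(1) r0 C_ge_1 by (intro ennreal_plus mult_nonneg_nonneg sum_nonneg) (auto simp: exc_def)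
        also have "ennreal (\<Sum>i\<in>active n. C * real n * exc i \<epsilon>) = (\<Sum>i\<in>active n. ennreal (C * real n) * ennreal (exc i \<epsilon>))"
          using C_ge_1 by (subst sum_ennreal[symmetric]) (auto simp: exc_def ennreal_mult)
        finally show "ennreal \<bar>threshold_estimator \<sigma> n (observations n f \<epsilon>) x - f x\<bar>
            \<le> ennreal (D * rate n t) + (\<Sum>i\<in>active n. ennreal (C * real n) * ennreal (exc i \<epsilon>))" .
      qed
    qed
    also have "\<dots> = ennreal (D * rate n t) + (\<Sum>i\<in>active n. ennreal (C * real n) * (\<integral>\<^sup>+\<epsilon>. ennreal (exc i \<epsilon>) \<partial>noise \<sigma> n))"
      using meas emeasure_noise_space[OF \<sigma>, of n]
      by (subst nn_integral_add) (auto simp: nn_integral_sum nn_integral_cmult)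
    also have "\<dots> \<le> ennreal (D * rate n t) + (\<Sum>i\<in>active n. ennreal (C * real n) * ennreal (2 * \<sigma> * real n powr (- 4)))"
      unfolding exc_def using coefficient_noise_excess[OF \<sigma> n]
      by (intro add_left_mono sum_mono mult_left_mono) (auto simp: active_def)
    also have "(\<Sum>i\<in>active n. ennreal (C * real n) * ennreal (2 * \<sigma> * real n powr (- 4)))
        = ennreal (real (card (active n)) * (C * real n * (2 * \<sigma> * real n powr (- 4))))"
      using C_ge_1 \<sigma> by (simp add: ennreal_mult ennreal_of_nat_eq_real_of_nat)
    also have "\<dots> \<le> ennreal (4 * C\<^sup>2 * \<sigma> * rate n t)"
    proof (rule ennreal_leI)
      have "real (card (active n)) * (C * real n * (2 * \<sigma> * real n powr (- 4)))
          \<le> (2 * C * real n) * (C * real n * (2 * \<sigma> * real n powr (- 4)))"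
        using card_active[of n] n C_ge_1 \<sigma> by (intro mult_right_mono) auto
      also have "\<dots> = 4 * C\<^sup>2 * \<sigma> * (real n powr 2 * real n powr (- 4))"
        using n0 by (simp add: power2_eq_square)
      also have "real n powr 2 * real n powr (- 4) = real n powr (- 2)" unfolding powr_add[symmetric] by simp
      also have "4 * C\<^sup>2 * \<sigma> * real n powr (- 2) \<le> 4 * C\<^sup>2 * \<sigma> * rate n t"
        using n t \<sigma> by (intro mult_left_mono powr_minus_le_rate) (auto simp: divide_le_eq)
      finally show "real (card (active n)) * (C * real n * (2 * \<sigma> * real n powr (- 4))) \<le> 4 * C\<^sup>2 * \<sigma> * rate n t" .
    qed
    also have "ennreal (D * rate n t) + ennreal (4 * C\<^sup>2 * \<sigma> * rate n t) = ennreal ((D + 4 * C\<^sup>2 * \<sigma>) * rate n t)"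
      using D(1) r0 \<sigma> by (subst ennreal_plus[symmetric]) (auto simp: algebra_simps)
    finally show "sup_risk \<sigma> n (threshold_estimator \<sigma> n) f \<le> ennreal ((D + 4 * C\<^sup>2 * \<sigma>) * rate n t)"
      by (simp add: add_left_mono)
  qed
qed

end


section \<open>Compactly supported Lipschitz functions\<close>

text \<open>
  One number \<open>R\<close> bounds the height, the Lipschitz constant and the radius of the support on \<open>S\<close>. The set \<open>S\<close> is the line
  for interior functions and the half line for edge functions, whose values at negative arguments are arbitrary.
\<close>

definition lipschitz_bump :: "real \<Rightarrow> real set \<Rightarrow> (real \<Rightarrow> real) \<Rightarrow> bool" where
  "lipschitz_bump R S g \<longleftrightarrow> 0 \<le> R \<and> (\<forall>x\<in>S. \<bar>g x\<bar> \<le> R \<and> (R < \<bar>x\<bar> \<longrightarrow> g x = 0)) \<and>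
     (\<forall>x\<in>S. \<forall>y\<in>S. \<bar>g x - g y\<bar> \<le> R * \<bar>x - y\<bar>)"

lemma lipschitz_bump_mono:
  assumes "lipschitz_bump R S g" "R \<le> R'"
  shows "lipschitz_bump R' S g"
  unfolding lipschitz_bump_def
proof (intro conjI ballI impI)
  show "0 \<le> R'" using assms by (simp add: lipschitz_bump_def)
  fix x assume x: "x \<in> S"
  show "\<bar>g x\<bar> \<le> R'" using assms x unfolding lipschitz_bump_def by force
  show "g x = 0" if "R' < \<bar>x\<bar>" using assms x that unfolding lipschitz_bump_def by auto
  fix y assume y: "y \<in> S"
  have "\<bar>g x - g y\<bar> \<le> R * \<bar>x - y\<bar>" using assms x y unfolding lipschitz_bump_def by blast
  also have "\<dots> \<le> R' * \<bar>x - y\<bar>" using assms by (intro mult_right_mono) auto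
  finally show "\<bar>g x - g y\<bar> \<le> R' * \<bar>x - y\<bar>" .
qed

lemma lipschitz_bump_cong: "lipschitz_bump R S g \<Longrightarrow> (\<And>x. x \<in> S \<Longrightarrow> g' x = g x) \<Longrightarrow> lipschitz_bump R S g'"
  unfolding lipschitz_bump_def by simp

lemma lipschitz_bump_add:
  assumes "lipschitz_bump R S g" "lipschitz_bump R' S g'"
  shows "lipschitz_bump (R + R') S (\<lambda>x. g x + g' x)"
  unfolding lipschitz_bump_def
proof (intro conjI ballI impI)
  show "0 \<le> R + R'" using assms by (simp add: lipschitz_bump_def)
  fix x assume x: "x \<in> S"
  show "\<bar>g x + g' x\<bar> \<le> R + R'"
    using assms x unfolding lipschitz_bump_def by (meson abs_triangle_ineq add_mono order.trans)
  show "g x + g' x = 0" if "R + R' < \<bar>x\<bar>"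
    using assms x that unfolding lipschitz_bump_def by auto
  fix y assume y: "y \<in> S"
  have "\<bar>g x - g y\<bar> \<le> R * \<bar>x - y\<bar>" "\<bar>g' x - g' y\<bar> \<le> R' * \<bar>x - y\<bar>"
    using assms x y unfolding lipschitz_bump_def by auto
  then show "\<bar>g x + g' x - (g y + g' y)\<bar> \<le> (R + R') * \<bar>x - y\<bar>"
    unfolding distrib_right by linarith
qed

lemma lipschitz_bump_cmult:
  assumes "lipschitz_bump R S g"
  shows "lipschitz_bump (max 1 \<bar>c\<bar> * R) S (\<lambda>x. c * g x)"
  unfolding lipschitz_bump_def
proof (intro conjI ballI impI)
  have R: "0 \<le> R" using assms by (simp add: lipschitz_bump_def)
  then show "0 \<le> max 1 \<bar>c\<bar> * R" by simp
  have le: "1 * R \<le> max 1 \<bar>c\<bar> * R" using R by (intro mult_right_mono) auto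
  fix x assume x: "x \<in> S"
  show "\<bar>c * g x\<bar> \<le> max 1 \<bar>c\<bar> * R"
    using assms x unfolding lipschitz_bump_def abs_mult by (intro mult_mono) auto
  show "c * g x = 0" if "max 1 \<bar>c\<bar> * R < \<bar>x\<bar>"
    using assms x that le unfolding lipschitz_bump_def by auto
  fix y assume y: "y \<in> S"
  have "\<bar>c * g x - c * g y\<bar> = \<bar>c\<bar> * \<bar>g x - g y\<bar>" by (simp flip: abs_mult right_diff_distrib)
  also have "\<dots> \<le> max 1 \<bar>c\<bar> * (R * \<bar>x - y\<bar>)"
    using assms x y unfolding lipschitz_bump_def by (intro mult_mono) auto
  finally show "\<bar>c * g x - c * g y\<bar> \<le> max 1 \<bar>c\<bar> * R * \<bar>x - y\<bar>" by (simp add: mult.assoc)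
qed

lemma lipschitz_bump_zero: "lipschitz_bump 0 S (\<lambda>x. 0)"
  by (simp add: lipschitz_bump_def)

lemma lipschitz_bump_sum:
  assumes "finite A" "\<And>i. i \<in> A \<Longrightarrow> \<exists>R. lipschitz_bump R S (g i)"
  shows "\<exists>R. lipschitz_bump R S (\<lambda>x. \<Sum>i\<in>A. c i * g i x)"
  using assms
proof (induction A)
  case empty
  then show ?case using lipschitz_bump_zero by auto
next
  case (insert i A)
  then obtain R R' where "lipschitz_bump R S (g i)" "lipschitz_bump R' S (\<lambda>x. \<Sum>i\<in>A. c i * g i x)" by blast
  from lipschitz_bump_add[OF lipschitz_bump_cmult[OF this(1), of "c i"] this(2)] insert show ?case by auto
qed

lemma lipschitz_bump_affine:
  assumes g: "lipschitz_bump R S g" and "a \<noteq> 0" and S: "\<And>x. x \<in> S' \<Longrightarrow> a * x + p \<in> S"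
  shows "\<exists>R'. lipschitz_bump R' S' (\<lambda>x. g (a * x + p))"
proof
  have R: "0 \<le> R" using g by (simp add: lipschitz_bump_def)
  let ?R = "max R (max (\<bar>a\<bar> * R) ((R + \<bar>p\<bar>) / \<bar>a\<bar>))"
  show "lipschitz_bump ?R S' (\<lambda>x. g (a * x + p))"
    unfolding lipschitz_bump_def
  proof (intro conjI ballI impI)
    show "0 \<le> ?R" using R by simp
    fix x assume x: "x \<in> S'"
    show "\<bar>g (a * x + p)\<bar> \<le> ?R"
      using g S[OF x] unfolding lipschitz_bump_def by (simp add: le_max_iff_disj)
    show "g (a * x + p) = 0" if "?R < \<bar>x\<bar>"
    proof -
      have "(R + \<bar>p\<bar>) / \<bar>a\<bar> < \<bar>x\<bar>" using that by simp
      then have "R + \<bar>p\<bar> < \<bar>a * x\<bar>" using \<open>a \<noteq> 0\<close> by (simp add: divide_less_eq abs_mult mult.commute)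
      then have "R < \<bar>a * x + p\<bar>" by linarith
      then show ?thesis using g S[OF x] unfolding lipschitz_bump_def by auto
    qed
    fix y assume y: "y \<in> S'"
    have "\<bar>g (a * x + p) - g (a * y + p)\<bar> \<le> R * \<bar>(a * x + p) - (a * y + p)\<bar>"
      using g S[OF x] S[OF y] unfolding lipschitz_bump_def by blast
    also have "(a * x + p) - (a * y + p) = a * (x - y)" by (simp add: algebra_simps)
    also have "R * \<bar>a * (x - y)\<bar> = (\<bar>a\<bar> * R) * \<bar>x - y\<bar>" by (simp add: abs_mult)
    also have "\<dots> \<le> ?R * \<bar>x - y\<bar>" by (intro mult_right_mono) auto
    finally show "\<bar>g (a * x + p) - g (a * y + p)\<bar> \<le> ?R * \<bar>x - y\<bar>" .
  qed
qed

lemma lipschitz_bump_uniform: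
  fixes N :: nat
  assumes "\<And>k. k < N \<Longrightarrow> \<exists>R. lipschitz_bump R S (g k)"
  shows "\<exists>R. \<forall>k<N. lipschitz_bump R S (g k)"
proof -
  obtain R where R: "\<And>k. k < N \<Longrightarrow> lipschitz_bump (R k) S (g k)" using assms by metis
  have "lipschitz_bump (\<Sum>k<N. R k) S (g k)" if "k < N" for k
  proof (rule lipschitz_bump_mono[OF R[OF that]])
    show "R k \<le> (\<Sum>k<N. R k)"
      using that R by (intro member_le_sum) (auto simp: lipschitz_bump_def)
  qed
  then show ?thesis by blast
qed


section \<open>Cohen--Daubechies--Vial wavelets\<close>

text \<open>
  For \<open>l = 1\<close> the derivative is itself the function required to be Hoelder; for larger \<open>l\<close> it is differentiable.
\<close>

lemma continuous_deriv_regular: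
  assumes "0 < l" "regularity_above l \<phi>"
  shows "continuous_on UNIV (deriv \<phi>)"
proof (cases "l = 1")
  case True
  then obtain \<alpha> C where \<alpha>: "\<alpha> > 0" "\<And>x y. \<bar>deriv \<phi> x - deriv \<phi> y\<bar> \<le> C * \<bar>x - y\<bar> powr \<alpha>"
    using assms(2) unfolding regularity_above_def True by (auto simp only: funpow.simps o_id One_nat_def)
  have "isCont (deriv \<phi>) x" for x
  proof -
    have "((\<lambda>y. \<bar>y - x\<bar>) \<longlongrightarrow> 0) (at x)"
      by (intro tendsto_rabs_zero LIM_zero tendsto_ident_at)
    from tendsto_mult_right_zero[OF tendsto_zero_powrI[OF this tendsto_const _ \<alpha>(1)], of C]
    have "((\<lambda>y. C * \<bar>y - x\<bar> powr \<alpha>) \<longlongrightarrow> 0) (at x)" by simp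
    then have "((\<lambda>y. deriv \<phi> y - deriv \<phi> x) \<longlongrightarrow> 0) (at x)"
      by (rule Lim_null_comparison[rotated]) (simp add: \<alpha>(2))
    then show ?thesis unfolding isCont_def by (rule LIM_zero_cancel)
  qed
  then show ?thesis by (simp add: continuous_on_eq_continuous_at)
next
  case False
  then have "deriv \<phi> differentiable (at x)" for x
  proof -
    have "1 < l" using False assms(1) by simp
    then have "(deriv ^^ 1) \<phi> differentiable (at x)"
      using assms(2) unfolding regularity_above_def by blast
    then show ?thesis by simp
  qed
  then show ?thesis
    by (auto simp: continuous_on_eq_continuous_at intro: differentiable_imp_continuous_within)
qed

text \<open>
  The continuous derivative is bounded on a compact interval beyond which the function vanishes, and
  projecting the arguments onto that interval does not increase their distance.
\<close>

lemma lipschitz_bump_scaling_function: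
  assumes "0 < l" "regularity_above l \<phi>" "scaling_function N h \<phi>"
  shows "\<exists>R. lipschitz_bump R UNIV \<phi>"
proof -
  \<comment> \<open>enlarging the support by \<open>1\<close> makes \<open>\<phi>\<close> vanish at the endpoints \<open>\<plusminus>L\<close>\<close>
  define L where "L = real N + 1"
  have L: "0 < L" by (simp add: L_def)
  have cont: "continuous_on UNIV \<phi>" and zero: "\<And>x. x \<notin> {1 - real N..real N} \<Longrightarrow> \<phi> x = 0"
    using assms(3) unfolding scaling_function_def by blast+
  have supp: "\<phi> x = 0" if "L \<le> \<bar>x\<bar>" for x
    using that by (intro zero) (auto simp: L_def)
  have diff: "(\<phi> has_real_derivative deriv \<phi> x) (at x)" for x
  proof -
    have "(deriv ^^ 0) \<phi> differentiable (at x)"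
      using assms(1,2) unfolding regularity_above_def by blast
    then show ?thesis by (simp add: DERIV_deriv_iff_real_differentiable)
  qed
  have "compact (deriv \<phi> ` {-L..L})" "compact (\<phi> ` {-L..L})"
    using continuous_deriv_regular[OF assms(1,2)] cont
    by (auto intro!: compact_continuous_image intro: continuous_on_subset)
  then obtain M M' where M: "\<And>x. x \<in> {-L..L} \<Longrightarrow> \<bar>deriv \<phi> x\<bar> \<le> M" "\<And>x. x \<in> {-L..L} \<Longrightarrow> \<bar>\<phi> x\<bar> \<le> M'"
    by (force dest!: compact_imp_bounded simp: bounded_iff)
  define R where "R = max L (max M M')"
  show ?thesis
  proof (intro exI[of _ R], unfold lipschitz_bump_def, intro conjI ballI impI)
    show "0 \<le> R" using L by (simp add: R_def)
    fix x :: real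
    show "\<bar>\<phi> x\<bar> \<le> R"
    proof (cases "\<bar>x\<bar> \<le> L")
      case True
      then have "\<bar>\<phi> x\<bar> \<le> M'" by (intro M(2)) auto
      then show ?thesis by (simp add: R_def le_max_iff_disj)
    qed (use supp[of x] L in \<open>simp add: R_def le_max_iff_disj\<close>)
    show "\<phi> x = 0" if "R < \<bar>x\<bar>" using supp[of x] that by (simp add: R_def)
    fix y :: real
    define cl where "cl = (\<lambda>x. max (- L) (min L x))"
    have cl: "\<phi> x = \<phi> (cl x)" "cl x \<in> {-L..L}" for x
      using supp[of x] supp[of L] supp[of "- L"] L by (auto simp: cl_def max_def min_def)
    have "norm (\<phi> (cl x) - \<phi> (cl y)) \<le> M * norm (cl x - cl y)"
      by (rule field_differentiable_bound[of "{-L..L}" _ "deriv \<phi>"])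
         (use M(1) cl(2) in \<open>auto intro: has_field_derivative_at_within[OF diff]\<close>)
    also have "\<dots> \<le> R * \<bar>x - y\<bar>"
      using \<open>0 \<le> R\<close> unfolding real_norm_def by (intro mult_mono) (auto simp: R_def cl_def)
    finally show "\<bar>\<phi> x - \<phi> y\<bar> \<le> R * \<bar>x - y\<bar>" by (simp flip: cl(1))
  qed
qed

lemma lipschitz_bump_mother_wavelet:
  assumes "lipschitz_bump R UNIV \<phi>"
  shows "\<exists>R. lipschitz_bump R UNIV (mother_wavelet N h \<phi>)"
proof -
  have "\<exists>R. lipschitz_bump R UNIV (\<lambda>x. \<phi> (2 * x - of_int k))" for k :: int
    using lipschitz_bump_affine[OF assms, of 2 UNIV "- of_int k"] by simp
  then have "\<exists>R. lipschitz_bump R UNIV (\<lambda>x. \<Sum>k = 1 - int N..int N.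
      (sqrt 2 * ((-1) powi k * h (1 - k))) * \<phi> (2 * x - of_int k))"
    by (intro lipschitz_bump_sum) auto
  then show ?thesis unfolding mother_wavelet_def by (simp add: sum_distrib_left mult.assoc)
qed

text \<open>
  The edge functions are finite linear combinations of translates and dilates: of \<open>\<phi>\<close> for the scaling
  functions, of \<open>\<phi>\<close> and the edge scaling functions for the wavelets.
\<close>

lemma lipschitz_bump_edge_system:
  assumes \<phi>: "lipschitz_bump R UNIV \<phi>" and sys: "edge_system N \<phi> \<psi> \<phi>E \<psi>E"
  shows "\<exists>R. \<forall>k<N. lipschitz_bump R {0..} (\<phi>E k)" "\<exists>R. \<forall>k<N. lipschitz_bump R {0..} (\<psi>E k)"
proof -
  note sys' = sys[unfolded edge_system_def]
  have span: "\<forall>k<N. \<exists>c. \<forall>x\<ge>0. \<phi>E k x = (\<Sum>i<N. c i * raw_edge N \<phi> i x)"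
    "\<forall>k<N. \<exists>c d. \<forall>x\<ge>0. \<psi>E k x =
        (\<Sum>i<N. c i * \<phi>E i (2 * x)) + (\<Sum>m = N..3 * N - 2. d m * \<phi> (2 * x - real m))"
    using conjunct1[OF sys'] conjunct1[OF conjunct2[OF conjunct2[OF sys']]] .
  have translate: "\<exists>R. lipschitz_bump R S (\<lambda>x. \<phi> (a * x + p))" if "a \<noteq> 0" for a p S
    using lipschitz_bump_affine[OF \<phi> that] by simp
  have raw: "\<exists>R. lipschitz_bump R S (raw_edge N \<phi> k)" for k S
  proof -
    have "\<exists>R. lipschitz_bump R S (\<lambda>x. \<phi> (x + real i - real N + 1))" for i
      using translate[of 1 S "real i - real N + 1"] by (simp add: algebra_simps)
    then show ?thesis unfolding raw_edge_def[abs_def] by (intro lipschitz_bump_sum) auto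
  qed
  have \<phi>E: "\<exists>R. lipschitz_bump R {0..} (\<phi>E k)" if k: "k < N" for k
  proof -
    obtain c where c: "\<forall>x\<ge>0. \<phi>E k x = (\<Sum>i<N. c i * raw_edge N \<phi> i x)"
      using span(1)[rule_format, OF k] ..
    obtain R where "lipschitz_bump R {0..} (\<lambda>x. \<Sum>i<N. c i * raw_edge N \<phi> i x)"
      using lipschitz_bump_sum[of "{..<N}" "{0..}" "raw_edge N \<phi>" c] raw by blast
    then have "lipschitz_bump R {0..} (\<phi>E k)" by (rule lipschitz_bump_cong) (simp add: c)
    then show ?thesis ..
  qed
  then show "\<exists>R. \<forall>k<N. lipschitz_bump R {0..} (\<phi>E k)" by (rule lipschitz_bump_uniform)
  have "\<exists>R. lipschitz_bump R {0..} (\<psi>E k)" if k: "k < N" for k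
  proof -
    obtain c d where cd: "\<forall>x\<ge>0. \<psi>E k x =
        (\<Sum>i<N. c i * \<phi>E i (2 * x)) + (\<Sum>m = N..3 * N - 2. d m * \<phi> (2 * x - real m))"
      using span(2)[rule_format, OF k] by (elim exE)
    have "\<exists>R. lipschitz_bump R {0..} (\<lambda>x. \<phi>E i (2 * x))" if i: "i < N" for i
    proof -
      obtain R where "lipschitz_bump R {0..} (\<phi>E i)" using \<phi>E[OF i] by blast
      from lipschitz_bump_affine[OF this, of 2 "{0..}" 0] show ?thesis by simp
    qed
    then have "\<exists>R. lipschitz_bump R {0..} (\<lambda>x. \<Sum>i<N. c i * \<phi>E i (2 * x))"
      by (intro lipschitz_bump_sum) auto
    then obtain R where R: "lipschitz_bump R {0..} (\<lambda>x. \<Sum>i<N. c i * \<phi>E i (2 * x))" by blast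
    have "\<exists>R. lipschitz_bump R {0..} (\<lambda>x. \<phi> (2 * x - real m))" for m
      using translate[of 2 "{0..}" "- real m"] by simp
    then have "\<exists>R. lipschitz_bump R {0..} (\<lambda>x. \<Sum>m = N..3 * N - 2. d m * \<phi> (2 * x - real m))"
      by (intro lipschitz_bump_sum) auto
    then obtain R' where R': "lipschitz_bump R' {0..} (\<lambda>x. \<Sum>m = N..3 * N - 2. d m * \<phi> (2 * x - real m))"
      by blast
    have "lipschitz_bump (R + R') {0..} (\<psi>E k)" by (rule lipschitz_bump_cong[OF lipschitz_bump_add[OF R R']]) (simp add: cd)
    then show ?thesis ..
  qed
  then show "\<exists>R. \<forall>k<N. lipschitz_bump R {0..} (\<psi>E k)" by (rule lipschitz_bump_uniform)
qed

text \<open>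
  Interior, left and right functions alike are rescalings \<open>2\<^bsup>j/2\<^esup> F(a x + p)\<close> with \<open>\<bar>a\<bar> = 2\<^sup>j\<close>; at the right
  edge \<open>a\<close> is negative. This lets the three cases share \<open>rescaled_bounds\<close>.
\<close>

lemma interval_level_rescaled:
  assumes "lipschitz_bump R UNIV f" "\<And>k. k < N \<Longrightarrow> lipschitz_bump R {0..} (fL k)" "\<And>k. k < N \<Longrightarrow> lipschitz_bump R {0..} (fR k)"
    and "m < 2 ^ j"
  obtains F S a p where "lipschitz_bump R S F" "\<bar>a\<bar> = 2 ^ j" "\<And>x. x \<in> {0..1} \<Longrightarrow> a * x + p \<in> S"
    "\<And>x. x \<in> {0..1} \<Longrightarrow> interval_level N f fL fR j m x = 2 powr (real j / 2) * F (a * x + p)"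
proof -
  consider "m < N" | "N \<le> m" "m < 2 ^ j - N" | "N \<le> m" "2 ^ j - N \<le> m" by linarith
  then show ?thesis
  proof cases
    case 1
    show ?thesis
      by (rule that[of "{0..}" "fL m" "2 ^ j" 0]) (use assms 1 in \<open>auto simp: interval_level_def\<close>)
  next
    case 2
    show ?thesis
      by (rule that[of UNIV f "2 ^ j" "- real m"]) (use assms 2 in \<open>auto simp: interval_level_def\<close>)
  next
    case 3
    show ?thesis
    proof (rule that[of "{0..}" "fR (2 ^ j - 1 - m)" "- (2 ^ j)" "2 ^ j"])
      show "lipschitz_bump R {0..} (fR (2 ^ j - 1 - m))" using assms(4) 3 by (intro assms(3)) linarith
    qed (use assms 3 in \<open>auto simp: interval_level_def algebra_simps\<close>)
  qed
qed

lemma rescaled_bounds: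
  assumes F: "lipschitz_bump R S F" and a: "\<bar>a\<bar> = 2 ^ j" and S: "\<And>x. x \<in> {0..1} \<Longrightarrow> a * x + p \<in> S"
    and g: "\<And>x. x \<in> {0..1} \<Longrightarrow> g x = 2 powr (real j / 2) * F (a * x + p)"
  shows "x \<in> {0..1} \<Longrightarrow> \<bar>g x\<bar> \<le> R * 2 powr (real j / 2)"
    and "x \<in> {0..1} \<Longrightarrow> y \<in> {0..1} \<Longrightarrow> \<bar>g x - g y\<bar> \<le> R * 2 powr (real j / 2) * (2 ^ j * \<bar>x - y\<bar>)"
    and "integral {0..1} (\<lambda>x. \<bar>g x\<bar>) \<le> 2 * R\<^sup>2 * 2 powr (- real j / 2)"
proof -
  have R: "0 \<le> R" using F by (simp add: lipschitz_bump_def)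
  have a0: "a \<noteq> 0" using a by auto
  show b: "\<bar>g x\<bar> \<le> R * 2 powr (real j / 2)" if "x \<in> {0..1}" for x
    using F S[OF that] by (simp add: g[OF that] abs_mult lipschitz_bump_def)
  show lip: "\<bar>g x - g y\<bar> \<le> R * 2 powr (real j / 2) * (2 ^ j * \<bar>x - y\<bar>)"
    if "x \<in> {0..1}" "y \<in> {0..1}" for x y
  proof -
    have "\<bar>F (a * x + p) - F (a * y + p)\<bar> \<le> R * \<bar>(a * x + p) - (a * y + p)\<bar>"
      using F S that unfolding lipschitz_bump_def by blast
    also have "(a * x + p) - (a * y + p) = a * (x - y)" by (simp add: algebra_simps)
    finally have "\<bar>F (a * x + p) - F (a * y + p)\<bar> \<le> R * (2 ^ j * \<bar>x - y\<bar>)"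
      by (simp add: abs_mult a)
    then have "2 powr (real j / 2) * \<bar>F (a * x + p) - F (a * y + p)\<bar> \<le> 2 powr (real j / 2) * (R * (2 ^ j * \<bar>x - y\<bar>))"
      by (intro mult_left_mono) auto
    moreover have "\<bar>g x - g y\<bar> = 2 powr (real j / 2) * \<bar>F (a * x + p) - F (a * y + p)\<bar>"
      unfolding g[OF that(1)] g[OF that(2)] by (simp add: abs_mult flip: right_diff_distrib)
    ultimately show ?thesis by (simp add: mult_ac)
  qed
  have cont: "continuous_on {0..1} g"
  proof (rule lipschitz_on_continuous_on)
    show "(R * 2 powr (real j / 2) * 2 ^ j)-lipschitz_on {0..1} g"
      using lip R by (intro lipschitz_onI) (auto simp: dist_real_def mult.assoc)
  qed
  define c where "c = - p / a"
  let ?T = "{c - R / 2 ^ j..c + R / 2 ^ j}"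
  let ?w = "R * 2 powr (real j / 2)"
  have supp: "x \<in> ?T" if "x \<in> {0..1}" "g x \<noteq> 0" for x
  proof -
    have "\<bar>a * x + p\<bar> \<le> R"
      using F S[OF that(1)] that(2) unfolding g[OF that(1)] lipschitz_bump_def by force
    moreover have "a * x + p = a * (x - c)" using a0 by (simp add: c_def field_simps)
    ultimately have "\<bar>x - c\<bar> \<le> R / 2 ^ j" by (simp add: abs_mult a le_divide_eq mult.commute)
    then show ?thesis by (auto simp: abs_le_iff)
  qed
  have int: "{0..1} \<inter> ?T = {max 0 (c - R / 2 ^ j)..min 1 (c + R / 2 ^ j)}"
    "?T \<inter> {0..1} = {max 0 (c - R / 2 ^ j)..min 1 (c + R / 2 ^ j)}" by auto
  have "integral {0..1} (\<lambda>x. \<bar>g x\<bar>) \<le> integral {0..1} (\<lambda>x. if x \<in> ?T then ?w else 0)"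
  proof (rule integral_le)
    show "(\<lambda>x. if x \<in> ?T then ?w else 0) integrable_on {0..1}"
      unfolding integrable_restrict_Int int by (rule integrable_const_ivl)
    show "\<bar>g x\<bar> \<le> (if x \<in> ?T then ?w else 0)" if "x \<in> {0..1}" for x
      using supp[OF that] b[OF that] by auto
  qed (intro integrable_continuous_interval continuous_intros cont)
  also have "\<dots> = integral {max 0 (c - R / 2 ^ j)..min 1 (c + R / 2 ^ j)} (\<lambda>x. ?w)"
    unfolding integral_restrict_Int int ..
  also have "\<dots> = measure lborel {max 0 (c - R / 2 ^ j)..min 1 (c + R / 2 ^ j)} * ?w"
    unfolding integral_const_real by simp
  also have "\<dots> \<le> (2 * (R / 2 ^ j)) * ?w"
    using R by (intro mult_right_mono) (auto simp: content_real_if)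
  also have "\<dots> = 2 * R\<^sup>2 * (2 powr (real j / 2) / 2 ^ j)" by (simp add: power2_eq_square)
  also have "2 powr (real j / 2) / 2 ^ j = 2 powr (- real j / 2)"
    by (simp add: powr_realpow[symmetric] powr_diff[symmetric])
  finally show "integral {0..1} (\<lambda>x. \<bar>g x\<bar>) \<le> 2 * R\<^sup>2 * 2 powr (- real j / 2)" .
qed

lemma card_nat_near:
  fixes y R :: real
  assumes "0 \<le> R"
  shows "finite {m::nat. \<bar>y - real m\<bar> \<le> R}" "real (card {m::nat. \<bar>y - real m\<bar> \<le> R}) \<le> 2 * R + 1"
proof -
  let ?A = "{\<lceil>y - R\<rceil>..\<lfloor>y + R\<rfloor>}"
  have sub: "{m::nat. \<bar>y - real m\<bar> \<le> R} \<subseteq> nat ` ?A"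
  proof
    fix m :: nat assume "m \<in> {m. \<bar>y - real m\<bar> \<le> R}"
    then have "int m \<in> ?A" by (auto simp: le_floor_iff ceiling_le_iff abs_le_iff)
    then show "m \<in> nat ` ?A" by (metis image_eqI nat_int)
  qed
  then show "finite {m::nat. \<bar>y - real m\<bar> \<le> R}" by (rule finite_subset) simp
  have "card {m::nat. \<bar>y - real m\<bar> \<le> R} \<le> card ?A"
    using card_mono[OF _ sub] card_image_le[of ?A nat] by simp
  also have "real (card ?A) \<le> 2 * R + 1"
    using assms by simp linarith
  finally show "real (card {m::nat. \<bar>y - real m\<bar> \<le> R}) \<le> 2 * R + 1" by simp
qed

text \<open>
  The \<open>2N\<close> edge functions are counted with no regard to their supports; an interior function that does
  not vanish at \<open>x\<close> has \<open>\<bar>2\<^sup>j x - m\<bar> \<le> R\<close>.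
\<close>

lemma interval_level_overlap:
  assumes f: "lipschitz_bump R UNIV f" and x: "x \<in> {0..1}"
  shows "real (card {m. m < 2 ^ j \<and> interval_level N f fL fR j m x \<noteq> 0}) \<le> 2 * real N + 2 * R + 1"
proof -
  have R: "0 \<le> R" using f by (simp add: lipschitz_bump_def)
  let ?A = "{..<N}" and ?B = "{2 ^ j - N..<2 ^ j}" and ?D = "{m. \<bar>2 ^ j * x - real m\<bar> \<le> R}"
  have "{m. m < 2 ^ j \<and> interval_level N f fL fR j m x \<noteq> 0} \<subseteq> ?A \<union> ?B \<union> ?D"
  proof
    fix m assume m: "m \<in> {m. m < 2 ^ j \<and> interval_level N f fL fR j m x \<noteq> 0}"
    show "m \<in> ?A \<union> ?B \<union> ?D"
    proof (cases "m < N \<or> 2 ^ j - N \<le> m")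
      case False
      then have "f (2 ^ j * x - real m) \<noteq> 0" using m by (auto simp: interval_level_def)
      then have "\<bar>2 ^ j * x - real m\<bar> \<le> R" using f unfolding lipschitz_bump_def by force
      then show ?thesis by simp
    qed (use m in auto)
  qed
  then have "card {m. m < 2 ^ j \<and> interval_level N f fL fR j m x \<noteq> 0} \<le> card (?A \<union> ?B \<union> ?D)"
    using card_nat_near(1)[OF R] by (intro card_mono) auto
  also have "\<dots> \<le> card ?A + card ?B + card ?D"
    by (intro order.trans[OF card_Un_le] add_right_mono card_Un_le)
  also have "\<dots> \<le> N + N + card ?D" by simp
  finally have "real (card {m. m < 2 ^ j \<and> interval_level N f fL fR j m x \<noteq> 0}) \<le> real (N + N + card ?D)"
    by (rule of_nat_mono)
  then show ?thesis using card_nat_near(2)[OF R, of "2 ^ j * x"] by simp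
qed

text \<open>
  The scaling functions are treated as further basis functions on the coarsest level \<open>J\<close>, which then carries
  two families.
\<close>

abbreviation "cdv_index J \<equiv> {..<(2::nat) ^ J} <+> wavelet_indices J"
abbreviation "cdv_level J \<equiv> case_sum (\<lambda>_::nat. J) (fst :: nat \<times> nat \<Rightarrow> nat)"
abbreviation "cdv_family \<Phi> \<Psi> \<equiv> case_sum \<Phi> (\<lambda>(j, m). \<Psi> j m)"

lemma cdv_level_card:
  "finite {i \<in> cdv_index J. cdv_level J i = j \<and> P i}"
  "card {i \<in> cdv_index J. cdv_level J i = j \<and> P i}
     \<le> (if j = J then card {m. m < 2 ^ j \<and> P (Inl m)} else 0) + (if J \<le> j then card {m. m < 2 ^ j \<and> P (Inr (j, m))} else 0)"
proof -
  let ?A = "if j = J then {m. m < 2 ^ j \<and> P (Inl m)} else {}"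
  let ?B = "if J \<le> j then {m. m < 2 ^ j \<and> P (Inr (j, m))} else {}"
  have eq: "{i \<in> cdv_index J. cdv_level J i = j \<and> P i} = Inl ` ?A \<union> (\<lambda>m. Inr (j, m)) ` ?B"
    by (auto simp: wavelet_indices_def Plus_def)
  show "finite {i \<in> cdv_index J. cdv_level J i = j \<and> P i}" unfolding eq by auto
  have "card (Inl ` ?A \<union> (\<lambda>m. Inr (j, m)) ` ?B) \<le> card ?A + card ?B"
    by (intro order.trans[OF card_Un_le] add_mono card_image_le) auto
  then show "card {i \<in> cdv_index J. cdv_level J i = j \<and> P i}
     \<le> (if j = J then card {m. m < 2 ^ j \<and> P (Inl m)} else 0) + (if J \<le> j then card {m. m < 2 ^ j \<and> P (Inr (j, m))} else 0)"
    unfolding eq by (auto split: if_splits)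
qed

lemma cdv_local_lipschitz:
  assumes "0 < l" "cdv_basis l J \<Phi> \<Psi>"
  shows "\<exists>C. local_lipschitz_basis (cdv_index J) (cdv_level J) (cdv_family \<Phi> \<Psi>) C"
proof -
  obtain N h \<phi> \<psi> \<phi>L \<psi>L \<phi>R \<psi>R where
    scal: "scaling_function N h \<phi>" and reg: "regularity_above l \<phi>"
    and \<psi>: "\<psi> = mother_wavelet N h \<phi>"
    and L: "edge_system N \<phi> \<psi> \<phi>L \<psi>L"
    and Rt: "edge_system N (\<lambda>x. \<phi> (1 - x)) (\<lambda>x. \<psi> (1 - x)) \<phi>R \<psi>R"
    and \<Phi>: "\<forall>m<2 ^ J. \<forall>x\<in>{0..1}. \<Phi> m x = interval_level N \<phi> \<phi>L \<phi>R J m x"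
    and \<Psi>: "\<forall>(j, m)\<in>wavelet_indices J. \<forall>x\<in>{0..1}. \<Psi> j m x = interval_level N \<psi> \<psi>L \<psi>R j m x"
    using assms(2) unfolding cdv_basis_def by blast
  have basis: "L2_orthonormal_basis {0..1} (cdv_index J) (cdv_family \<Phi> \<Psi>)"
    using assms(2) unfolding cdv_basis_def by simp
  obtain R1 where R1: "lipschitz_bump R1 UNIV \<phi>" using lipschitz_bump_scaling_function[OF assms(1) reg scal] by blast
  obtain R2 where R2: "lipschitz_bump R2 UNIV \<psi>" using lipschitz_bump_mother_wavelet[OF R1] \<psi> by blast
  obtain R3 R4 where R34: "\<forall>k<N. lipschitz_bump R3 {0..} (\<phi>L k)" "\<forall>k<N. lipschitz_bump R4 {0..} (\<psi>L k)"
    using lipschitz_bump_edge_system[OF R1 L] by blast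
  obtain R0 where R0: "lipschitz_bump R0 UNIV (\<lambda>x. \<phi> (1 - x))"
    using lipschitz_bump_affine[OF R1, of "- 1" UNIV 1] by auto
  obtain R5 R6 where R56: "\<forall>k<N. lipschitz_bump R5 {0..} (\<phi>R k)" "\<forall>k<N. lipschitz_bump R6 {0..} (\<psi>R k)"
    using lipschitz_bump_edge_system[OF R0 Rt] by blast
  define R where "R = Max {R1, R2, R3, R4, R5, R6}"
  have le: "R1 \<le> R" "R2 \<le> R" "R3 \<le> R" "R4 \<le> R" "R5 \<le> R" "R6 \<le> R" unfolding R_def by auto
  have R: "0 \<le> R" using R1 le(1) by (simp add: lipschitz_bump_def)
  have t\<phi>: "lipschitz_bump R UNIV \<phi>" "\<And>k. k < N \<Longrightarrow> lipschitz_bump R {0..} (\<phi>L k)" "\<And>k. k < N \<Longrightarrow> lipschitz_bump R {0..} (\<phi>R k)"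
    and t\<psi>: "lipschitz_bump R UNIV \<psi>" "\<And>k. k < N \<Longrightarrow> lipschitz_bump R {0..} (\<psi>L k)" "\<And>k. k < N \<Longrightarrow> lipschitz_bump R {0..} (\<psi>R k)"
    using R1 R2 R34 R56 le by (auto intro: lipschitz_bump_mono)
  \<comment> \<open>the overlap of one family is at most \<open>2N + 2R + 1\<close>; it is doubled since level \<open>J\<close> carries two\<close>
  define C where "C = 4 * real N + 5 * R + 2 * R\<^sup>2 + 2"
  have C: "1 \<le> C" "2 \<le> C" "R \<le> C" "2 * R\<^sup>2 \<le> C" "2 * (2 * real N + 2 * R + 1) \<le> C"
    unfolding C_def using R by auto
  let ?e = "cdv_family \<Phi> \<Psi>"
  have local: "\<exists>F S a p. lipschitz_bump R S F \<and> \<bar>a\<bar> = 2 ^ cdv_level J i \<and> (\<forall>x\<in>{0..1}. a * x + p \<in> S) \<and>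
      (\<forall>x\<in>{0..1}. ?e i x = 2 powr (real (cdv_level J i) / 2) * F (a * x + p))" if i: "i \<in> cdv_index J" for i
  proof (cases i)
    case (Inl m)
    then have m: "m < 2 ^ J" using i by auto
    show ?thesis
      by (rule interval_level_rescaled[OF t\<phi> m]) (use \<Phi> m Inl in \<open>auto intro!: exI\<close>)
  next
    case (Inr jm)
    then obtain j m where jm: "jm = (j, m)" "(j, m) \<in> wavelet_indices J" using i by (cases jm) auto
    then have m: "m < 2 ^ j" by (auto simp: wavelet_indices_def)
    show ?thesis
      by (rule interval_level_rescaled[OF t\<psi> m]) (use \<Psi> m jm Inr in \<open>auto intro!: exI\<close>)
  qed
  have "local_lipschitz_basis (cdv_index J) (cdv_level J) ?e C"
  proof
    show "1 \<le> C" by (rule C)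
    show "L2_orthonormal_basis {0..1} (cdv_index J) ?e" by (rule basis)
    show "finite {i \<in> cdv_index J. cdv_level J i = j}" for j
      using cdv_level_card(1)[of J j "\<lambda>_. True"] by simp
    show "real (card {i \<in> cdv_index J. cdv_level J i = j}) \<le> C * 2 ^ j" for j
    proof -
      have "card {i \<in> cdv_index J. cdv_level J i = j} \<le> 2 * 2 ^ j"
        using cdv_level_card(2)[of J j "\<lambda>_. True"] by (auto split: if_splits)
      then have "real (card {i \<in> cdv_index J. cdv_level J i = j}) \<le> real (2 * 2 ^ j)"
        by (rule of_nat_mono)
      also have "\<dots> \<le> C * 2 ^ j" using C by simp
      finally show ?thesis .
    qed
    show "real (card {i \<in> cdv_index J. cdv_level J i = j \<and> ?e i x \<noteq> 0}) \<le> C" if x: "x \<in> {0..1}" for x j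
    proof -
      let ?P = "\<lambda>i. ?e i x \<noteq> 0"
      have "real (card {m. m < 2 ^ j \<and> ?P (Inl m)}) \<le> 2 * real N + 2 * R + 1" if "j = J"
      proof -
        have "{m. m < 2 ^ j \<and> ?P (Inl m)} = {m. m < 2 ^ j \<and> interval_level N \<phi> \<phi>L \<phi>R j m x \<noteq> 0}"
          using \<Phi> x that by auto
        then show ?thesis using interval_level_overlap[OF t\<phi>(1) x] by simp
      qed
      moreover have "real (card {m. m < 2 ^ j \<and> ?P (Inr (j, m))}) \<le> 2 * real N + 2 * R + 1" if "J \<le> j"
      proof -
        have "{m. m < 2 ^ j \<and> ?P (Inr (j, m))} = {m. m < 2 ^ j \<and> interval_level N \<psi> \<psi>L \<psi>R j m x \<noteq> 0}"
          using \<Psi> x that by (auto simp: wavelet_indices_def)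
        then show ?thesis using interval_level_overlap[OF t\<psi>(1) x] by simp
      qed
      ultimately show ?thesis
        using cdv_level_card(2)[of J j ?P] C(5) R by (auto split: if_splits)
    qed
    fix i assume i: "i \<in> cdv_index J"
    obtain F S a p where F: "lipschitz_bump R S F" "\<bar>a\<bar> = 2 ^ cdv_level J i" "\<And>x. x \<in> {0..1} \<Longrightarrow> a * x + p \<in> S"
      "\<And>x. x \<in> {0..1} \<Longrightarrow> ?e i x = 2 powr (real (cdv_level J i) / 2) * F (a * x + p)"
      using local[OF i] by blast
    note bounds = rescaled_bounds[where g = "?e i" and p = p, OF F(1,2)]
    show "\<bar>?e i x\<bar> \<le> C * 2 powr (real (cdv_level J i) / 2)" if x: "x \<in> {0..1}" for x
    proof -
      have "\<bar>?e i x\<bar> \<le> R * 2 powr (real (cdv_level J i) / 2)"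
        by (rule bounds(1), erule F(3), erule F(4), rule x)
      also have "\<dots> \<le> C * 2 powr (real (cdv_level J i) / 2)"
        using C by (intro mult_right_mono) auto
      finally show ?thesis .
    qed
    show "\<bar>?e i x - ?e i y\<bar> \<le> C * 2 powr (real (cdv_level J i) / 2) * (2 ^ cdv_level J i * \<bar>x - y\<bar>)"
      if x: "x \<in> {0..1}" and y: "y \<in> {0..1}" for x y
    proof -
      have "\<bar>?e i x - ?e i y\<bar> \<le> R * 2 powr (real (cdv_level J i) / 2) * (2 ^ cdv_level J i * \<bar>x - y\<bar>)"
        by (rule bounds(2), erule F(3), erule F(4), rule x, rule y)
      also have "\<dots> \<le> C * 2 powr (real (cdv_level J i) / 2) * (2 ^ cdv_level J i * \<bar>x - y\<bar>)"
        using C by (intro mult_right_mono) auto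
      finally show ?thesis .
    qed
    show "integral {0..1} (\<lambda>x. \<bar>?e i x\<bar>) \<le> C * 2 powr (- real (cdv_level J i) / 2)"
    proof -
      have "integral {0..1} (\<lambda>x. \<bar>?e i x\<bar>) \<le> 2 * R\<^sup>2 * 2 powr (- real (cdv_level J i) / 2)"
        by (rule bounds(3), erule F(3), erule F(4))
      also have "\<dots> \<le> C * 2 powr (- real (cdv_level J i) / 2)"
        using C by (intro mult_right_mono) auto
      finally show ?thesis .
    qed
  qed
  then show ?thesis by blast
qed

text \<open>
  The factor \<open>2\<^bsup>J(t+1/2)\<^esup>\<close> is due to the scaling functions, which count as functions of level \<open>J\<close> although their
  coefficients are only bounded by \<open>B\<close>.
\<close>

lemma smoothness_class_decay:
  assumes f: "f \<in> smoothness_class J \<Phi> \<Psi> B t" and t: "0 < t" and B: "0 < B" and i: "i \<in> cdv_index J"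
  shows "\<bar>L2_inner {0..1} (cdv_family \<Phi> \<Psi> i) f\<bar>
           \<le> B * 2 powr (real J * (t + 1/2)) * 2 powr (- real (cdv_level J i) * (t + 1/2))"
proof -
  have norm: "(SUP m\<in>{..<2 ^ J}. ereal \<bar>L2_inner {0..1} (\<Phi> m) f\<bar>) \<le> ereal B"
    "(SUP (j, m)\<in>wavelet_indices J. ereal (2 powr (real j * (t + 1/2)) * \<bar>L2_inner {0..1} (\<Psi> j m) f\<bar>)) \<le> ereal B"
    using f unfolding smoothness_class_def wavelet_norm_def mem_Collect_eq max.bounded_iff by blast+
  show ?thesis
  proof (cases i)
    case (Inl m)
    then have "\<bar>L2_inner {0..1} (\<Phi> m) f\<bar> \<le> B"
      using norm(1) i unfolding SUP_le_iff by auto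
    then show ?thesis using Inl by (simp add: mult.assoc flip: powr_add)
  next
    case (Inr jm)
    then obtain j m where jm: "jm = (j, m)" "(j, m) \<in> wavelet_indices J" using i by (cases jm) auto
    let ?p = "2 powr (real j * (t + 1/2)) :: real"
    have "?p * \<bar>L2_inner {0..1} (\<Psi> j m) f\<bar> \<le> B"
      using bspec[OF norm(2)[unfolded SUP_le_iff] jm(2)] by simp
    also have "\<dots> \<le> B * 2 powr (real J * (t + 1/2))"
      using B t by (simp add: ge_one_powr_ge_zero)
    finally have "\<bar>L2_inner {0..1} (\<Psi> j m) f\<bar> \<le> B * 2 powr (real J * (t + 1/2)) / ?p"
      by (simp add: le_divide_eq mult.commute)
    also have "\<dots> = B * 2 powr (real J * (t + 1/2)) * 2 powr (- real j * (t + 1/2))"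
      by (simp add: powr_minus_divide)
    finally show ?thesis using Inr jm by simp
  qed
qed

theorem theorem1:
  fixes \<sigma> :: real and l J :: nat
    and \<Phi> :: "nat \<Rightarrow> real \<Rightarrow> real" and \<Psi> :: "nat \<Rightarrow> nat \<Rightarrow> real \<Rightarrow> real"
  assumes "\<sigma> > 0" and "l > 0" and "cdv_basis l J \<Phi> \<Psi>"
  shows "\<exists>fhat :: nat \<Rightarrow> (nat \<Rightarrow> real) \<Rightarrow> real \<Rightarrow> real.
           (\<forall>n. estimator n (fhat n)) \<and>
           (\<forall>B>0. \<exists>n\<^sub>0::nat. \<forall>t. 0 < t \<and> t \<le> real l \<longrightarrow>
              (\<exists>D::real. \<forall>n\<ge>n\<^sub>0.
                 (SUP f\<in>smoothness_class J \<Phi> \<Psi> B t. sup_risk \<sigma> n (fhat n) f)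
                   \<le> ennreal (D * rate n t)))"
proof -
  obtain C where "local_lipschitz_basis (cdv_index J) (cdv_level J) (cdv_family \<Phi> \<Psi>) C"
    using cdv_local_lipschitz[OF assms(2,3)] by blast
  then interpret local_lipschitz_basis "cdv_index J" "cdv_level J" "cdv_family \<Phi> \<Psi>" C .
  \<comment> \<open>\<open>n \<ge> 3\<close> ensures \<open>log n \<ge> 1\<close>, so that the rate dominates \<open>n\<^bsup>-t/(2t+1)\<^esup>\<close>\<close>
  show ?thesis
  proof (intro exI[of _ "threshold_estimator \<sigma>"] conjI allI impI exI[of _ "3::nat"] estimator_threshold_estimator)
    fix B t :: real assume B: "0 < B" and t: "0 < t \<and> t \<le> real l"
    define b where "b = B * 2 powr (real J * (t + 1/2))"
    have "0 \<le> b" using B by (simp add: b_def)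
    then obtain D where D: "\<And>f n. continuous_on {0..1} f \<Longrightarrow>
        (\<And>i. i \<in> cdv_index J \<Longrightarrow> \<bar>coef f i\<bar> \<le> b * 2 powr (- real (cdv_level J i) * (t + 1/2))) \<Longrightarrow> 3 \<le> n \<Longrightarrow>
        sup_risk \<sigma> n (threshold_estimator \<sigma> n) f \<le> ennreal (D * rate n t)"
      using sup_risk_bound[OF assms(1), of t b] t by blast
    show "\<exists>D. \<forall>n\<ge>3. (SUP f\<in>smoothness_class J \<Phi> \<Psi> B t. sup_risk \<sigma> n (threshold_estimator \<sigma> n) f) \<le> ennreal (D * rate n t)"
    proof (intro exI[of _ D] allI impI SUP_least)
      fix n f assume n: "3 \<le> (n::nat)" and f: "f \<in> smoothness_class J \<Phi> \<Psi> B t"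
      show "sup_risk \<sigma> n (threshold_estimator \<sigma> n) f \<le> ennreal (D * rate n t)"
      proof (rule D[OF _ _ n])
        show "continuous_on {0..1} f" using f by (simp add: smoothness_class_def)
        show "\<bar>coef f i\<bar> \<le> b * 2 powr (- real (cdv_level J i) * (t + 1/2))" if "i \<in> cdv_index J" for i
          unfolding coef_def b_def using smoothness_class_decay[OF f _ B that] t by simp
      qed
    qed
  qed
qed

end
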